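(* Let $\Pi$ be a finitely generated abelian group and let $S$ be a finitely generated $\Pi$-set. Then for any preotree $\tau$ for $(\Pi,S)$ and for any numerical data $(f_x,g_x)_x$ for $\tau$, the relation $\leq$ on $S$ determined by $\tau$ and $(f_x,g_x)_x$ is a preorder on the $\Pi$-set $S$. Conversely, any preorder on the $\Pi$-set $S$ arises in this manner.
   Context: A $\Pi$-set $S$ is finitely generated if it is a union of finitely many orbits. A preorder on the $\Pi$-set $S$ is a reflexive, transitive, and total relation $\leq$ on $S$ with $r\leq s\Rightarrow ur\leq us$ for all $r,s\in S$, $u\in\Pi$. A subgroup is saturated if the quotient by it is a free abelian group. Preotree. A preotree $\tau$ for $(\Pi,S)$ is a finite rooted tree in which each vertex $x$ is labelled by a pair $(\Pi_x,S_x)$ consisting of a saturated subgroup $\Pi_x$ of $\Pi$ and a $\Pi_x$-stable subset $S_x$ of $S$, such that: (1) for the root $r$, $\Pi_r=\Pi$ and $S_r=S$; (2) for a child $y$ of a vertex $x$, $S_y\subseteq S_x$ and $\Pi_y$ is a saturated subgroup of $\Pi_x$ that contains all stabilisers of elements in $S_x$; (3) if the set $Y$ of children of $x$ is nonempty, then $\Pi_y$ is the same for all $y\in Y$, the sets $S_y$ ($y\in Y$) are disjoint, and $\bigsqcup_{y\in Y}S_y$ intersects each $\Pi_x$-orbit in $S_x$ in precisely one $\Pi_y$-orbit. Numerical data. Numerical data for $\tau$ consists of, for each non-leaf $x$, a homomorphism $f_x:\Pi_x\to(\mathbb{R},+)$ and a map $g_x:S_x\to\mathbb{R}$ such that: (1)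 $g_x(us)=f_x(u)+g_x(s)$ for all $u\in\Pi_x$, $s\in S_x$; (2) for each child $y$ of $x$, $\Pi_y=\ker(f_x)$ and $g_x$ is constant on $S_y$, with value denoted $g_x(S_y)$; (3) for distinct children $y,z$ of $x$ and $s\in S_y$, $t\in S_z$, the numbers $g_x(s)$ and $g_x(t)$ are in distinct cosets of $\mathrm{im}(f_x)$ in $\mathbb{R}$; (4) if $\mathrm{im}(f_x)\cong\Pi_x/\ker(f_x)$ has rank $1$ and is generated by $u_0+\ker(f_x)$, then $g_x(S_y)\in(0,|f_x(u_0)|)$ for every child $y$ of $x$. Relation determined by $\tau$ and numerical data. It is defined recursively. If the root $r$ is a leaf, then $s\leq t$ for all $s,t\in S$. Otherwise, $s\leq t$ holds if either $g_r(s)<g_r(t)$, or else $g_r(s)=g_r(t)$ and the following holds: pick $u\in\Pi_r$ such that $us\in S_y$ for some child $y$ of $r$ (such $u$ exists, $y$ does not depend on $u$, and then also $ut\in S_y$); one requires $us\leq ut$ in the relation on $S_y$ determined by the sub-preotree of $\tau$ rooted at $y$ (a preotree for $(\Pi_y,S_y)$) with the numerical data it inherits. This is independent of the choice of $u$. *)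

theory Defs
  imports
    Complex_Main
    "HOL-Library.Disjoint_Sets"
    "HOL-Algebra.Free_Abelian_Groups"
    "HOL-Algebra.Group_Action"
    "HOL-Algebra.Generated_Groups"
begin

section \<open>Groups and group actions\<close>

definition real_group :: "real monoid"
  where "real_group = \<lparr>carrier = UNIV, monoid.mult = (+), one = 0\<rparr>"

definition finitely_generated_group :: "('g, 'm) monoid_scheme \<Rightarrow> bool"
  where "finitely_generated_group G \<longleftrightarrow>
    (\<exists>A. finite A \<and> A \<subseteq> carrier G \<and> generate G A = carrier G)"

text \<open>A basis of \<open>K\<close> is a subset of \<open>K\<close>, so it is no restriction that the index set of
  the free abelian group has the element type of \<open>K\<close>.\<close>

definition free_abelian :: "('g, 'm) monoid_scheme \<Rightarrow> bool"
  where "free_abelian K \<longleftrightarrow> (\<exists>B :: 'g set. K \<cong> free_Abelian_group B)"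

definition free_abelian_of_rank :: "('g, 'm) monoid_scheme \<Rightarrow> nat \<Rightarrow> bool"
  where "free_abelian_of_rank K n \<longleftrightarrow>
    (\<exists>B :: 'g set. finite B \<and> card B = n \<and> K \<cong> free_Abelian_group B)"

definition saturated :: "('g, 'm) monoid_scheme \<Rightarrow> 'g set \<Rightarrow> bool"
  where "saturated G H \<longleftrightarrow> subgroup H G \<and> free_abelian (G Mod H)"

definition finitely_generated_set ::
    "('g, 'm) monoid_scheme \<Rightarrow> 's set \<Rightarrow> ('g \<Rightarrow> 's \<Rightarrow> 's) \<Rightarrow> bool"
  where "finitely_generated_set G S \<phi> \<longleftrightarrow> finite (orbits G S \<phi>)"

definition stable :: "('g \<Rightarrow> 's \<Rightarrow> 's) \<Rightarrow> 'g set \<Rightarrow> 's set \<Rightarrow> bool"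
  where "stable \<phi> H T \<longleftrightarrow> (\<forall>u\<in>H. \<forall>s\<in>T. \<phi> u s \<in> T)"

text \<open>\<open>(s, t) \<in> R\<close> stands for \<open>s \<le> t\<close>.\<close>

definition action_preorder ::
    "('g, 'm) monoid_scheme \<Rightarrow> 's set \<Rightarrow> ('g \<Rightarrow> 's \<Rightarrow> 's) \<Rightarrow> 's rel \<Rightarrow> bool"
  where "action_preorder G S \<phi> R \<longleftrightarrow>
    preorder_on S R \<and> total_on S R \<and>
    (\<forall>u\<in>carrier G. \<forall>r\<in>S. \<forall>s\<in>S. (r, s) \<in> R \<longrightarrow> (\<phi> u r, \<phi> u s) \<in> R)"


section \<open>Preotrees\<close>

text \<open>Finite rooted trees with vertices labelled by a pair (\<open>grp\<close>, \<open>pts\<close>). The order of the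
  children in the list plays no role. A vertex is addressed by its position, the list of
  child indices on the path from the root; \<open>subtree \<tau> p\<close> is the subtree rooted there.\<close>

datatype ('g, 's) ltree =
  Vertex (grp: "'g set") (pts: "'s set") (children: "('g, 's) ltree list")

fun subtree :: "('g, 's) ltree \<Rightarrow> nat list \<Rightarrow> ('g, 's) ltree" where
  "subtree \<tau> [] = \<tau>"
| "subtree \<tau> (i # p) = subtree (children \<tau> ! i) p"

lemma size_nth_child: "i < length ts \<Longrightarrow> size (ts ! i) < Suc (size_list size ts)"
  by (meson le_imp_less_Suc nth_mem order_refl size_list_estimation')

function vertices :: "('g, 's) ltree \<Rightarrow> nat list set" where
  "vertices (Vertex P X ts) = insert [] (\<Union>i\<in>{..<length ts}. (#) i ` vertices (ts ! i))"
  by pat_completeness auto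
termination by (relation "measure size") (auto simp: size_nth_child)

text \<open>The conditions (2) and (3) relating a vertex \<open>x\<close> to its children.\<close>

definition children_ok ::
    "('g, 'm) monoid_scheme \<Rightarrow> ('g \<Rightarrow> 's \<Rightarrow> 's) \<Rightarrow> ('g, 's) ltree \<Rightarrow> bool"
  where "children_ok G \<phi> x \<longleftrightarrow>
    (\<forall>y\<in>set (children x).
       pts y \<subseteq> pts x \<and>
       saturated (G\<lparr>carrier := grp x\<rparr>) (grp y) \<and>
       (\<forall>s\<in>pts x. stabilizer (G\<lparr>carrier := grp x\<rparr>) \<phi> s \<subseteq> grp y)) \<and>
    (children x \<noteq> [] \<longrightarrow>
       (\<forall>y\<in>set (children x). \<forall>z\<in>set (children x). grp y = grp z) \<and>
       disjoint_family_on (\<lambda>i. pts (children x ! i)) {..<length (children x)} \<and>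
       (\<forall>O\<^sub>x\<in>orbits (G\<lparr>carrier := grp x\<rparr>) (pts x) \<phi>. \<forall>y\<in>set (children x).
          (\<Union>z\<in>set (children x). pts z) \<inter> O\<^sub>x \<in> orbits (G\<lparr>carrier := grp y\<rparr>) (pts x) \<phi>))"

definition preotree ::
    "('g, 'm) monoid_scheme \<Rightarrow> 's set \<Rightarrow> ('g \<Rightarrow> 's \<Rightarrow> 's) \<Rightarrow> ('g, 's) ltree \<Rightarrow> bool"
  where "preotree G S \<phi> \<tau> \<longleftrightarrow>
    grp \<tau> = carrier G \<and> pts \<tau> = S \<and>
    (\<forall>p\<in>vertices \<tau>. let x = subtree \<tau> p in
       saturated G (grp x) \<and> pts x \<subseteq> S \<and> stable \<phi> (grp x) (pts x) \<and> children_ok G \<phi> x)"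


section \<open>Numerical data\<close>

text \<open>The conditions (1) to (4) on the pair \<open>f\<close>, \<open>g\<close> attached to a single non-leaf \<open>x\<close>.
  Only the values of \<open>f\<close> on \<open>grp x\<close> and of \<open>g\<close> on \<open>pts x\<close> matter. In the last condition,
  \<open>g\<close> takes on all of \<open>pts y\<close> the single value written \<open>g\<^sub>x(S\<^sub>y)\<close>; nothing is required of
  a child with empty \<open>pts y\<close>.\<close>

definition vertex_data ::
    "('g, 'm) monoid_scheme \<Rightarrow> ('g \<Rightarrow> 's \<Rightarrow> 's) \<Rightarrow> ('g, 's) ltree \<Rightarrow>
     ('g \<Rightarrow> real) \<Rightarrow> ('s \<Rightarrow> real) \<Rightarrow> bool"
  where "vertex_data G \<phi> x f g \<longleftrightarrow>
    (let P = G\<lparr>carrier := grp x\<rparr>; K = kernel P real_group f; ys = children x in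
      f \<in> hom P real_group \<and>
      (\<forall>u\<in>grp x. \<forall>s\<in>pts x. g (\<phi> u s) = f u + g s) \<and>
      (\<forall>y\<in>set ys. grp y = K \<and> (\<exists>c. \<forall>s\<in>pts y. g s = c)) \<and>
      (\<forall>i<length ys. \<forall>j<length ys. i \<noteq> j \<longrightarrow>
         (\<forall>s\<in>pts (ys ! i). \<forall>t\<in>pts (ys ! j).
            f ` grp x #>\<^bsub>real_group\<^esub> g s \<noteq> f ` grp x #>\<^bsub>real_group\<^esub> g t)) \<and>
      (free_abelian_of_rank (P Mod K) 1 \<longrightarrow>
         (\<forall>u\<^sub>0\<in>grp x. generate (P Mod K) {K #>\<^bsub>P\<^esub> u\<^sub>0} = carrier (P Mod K) \<longrightarrow>
            (\<forall>y\<in>set ys. \<forall>s\<in>pts y. g s \<in> {0<..<\<bar>f u\<^sub>0\<bar>}))))"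

definition numerical_data ::
    "('g, 'm) monoid_scheme \<Rightarrow> ('g \<Rightarrow> 's \<Rightarrow> 's) \<Rightarrow> ('g, 's) ltree \<Rightarrow>
     (nat list \<Rightarrow> 'g \<Rightarrow> real) \<Rightarrow> (nat list \<Rightarrow> 's \<Rightarrow> real) \<Rightarrow> bool"
  where "numerical_data G \<phi> \<tau> f g \<longleftrightarrow>
    (\<forall>p\<in>vertices \<tau>. children (subtree \<tau> p) \<noteq> [] \<longrightarrow>
       vertex_data G \<phi> (subtree \<tau> p) (f p) (g p))"


section \<open>The relation determined by a preotree and numerical data\<close>

text \<open>The homomorphisms \<open>f\<close> do not enter the recursion. The subtree at the \<open>i\<close>-th child
  inherits the data \<open>\<lambda>p. g (i # p)\<close>. Since the choice of \<open>u\<close> is immaterial for numerical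
  data on a preotree, it is rendered by an existential quantifier.\<close>

function determined_rel ::
    "('g \<Rightarrow> 's \<Rightarrow> 's) \<Rightarrow> ('g, 's) ltree \<Rightarrow> (nat list \<Rightarrow> 's \<Rightarrow> real) \<Rightarrow> 's rel" where
  "determined_rel \<phi> (Vertex P X ts) g =
    (if ts = [] then X \<times> X
     else {(s, t). s \<in> X \<and> t \<in> X \<and>
             (g [] s < g [] t \<or>
              g [] s = g [] t \<and>
              (\<exists>u\<in>P. \<exists>i\<in>{..<length ts}. \<phi> u s \<in> pts (ts ! i) \<and>
                 (\<phi> u s, \<phi> u t) \<in> determined_rel \<phi> (ts ! i) (\<lambda>p. g (i # p))))})"
  by pat_completeness auto
termination
  by (relation "measure (\<lambda>(\<phi>, \<tau>, g). size \<tau>)") (auto simp: size_nth_child)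

end

theory Submission
  imports Defs
begin

text \<open>That a determined relation is a preorder follows by induction on the tree: at a vertex it is a
  lexicographic combination of the values of \<open>g\<close> and of the relations at the children.

  For the converse, let \<open>P\<close> be a finitely generated saturated subgroup acting on \<open>X\<close>, with a
  preorder that is not \<open>X \<times> X\<close>. If some orbit is not coinitial in \<open>X\<close>, say without elements
  below \<open>t\<close>, then the set of points with a translate below \<open>t\<close> and its complement are nonempty and stable, and the former lies
  strictly below the latter; take \<open>f = 0\<close> and let \<open>g\<close> separate them. Otherwise fix a point \<open>s\<close>: as in
  Hoelder's theorem, the preorder on the orbit of \<open>s\<close> yields a nonzero monotone homomorphism \<open>f\<close> from
  \<open>P\<close> to the reals, and \<open>g t\<close>, the supremum of \<open>f u\<close> over all \<open>u s \<le> t\<close>, is monotone and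
  equivariant. The children are the fibres of \<open>g\<close> over a transversal of the cosets of the image of \<open>f\<close>,
  where a constant is added to \<open>g\<close> to satisfy the condition on cyclic images. At each step the
  number of generators of the group plus the number of orbits decreases, because the kernel of a
  nonzero \<open>f\<close> is generated by fewer elements.\<close>

section \<open>Pure subgroups of finitely generated abelian groups\<close>

text \<open>Equivalently, the quotient is torsion-free. In a finitely generated abelian group this
  yields \<open>saturated\<close>, and it is far easier to verify for kernels of real-valued
  homomorphisms than freeness of a quotient.\<close>

definition pure_subgroup :: "('g, 'm) monoid_scheme \<Rightarrow> 'g set \<Rightarrow> bool"
  where "pure_subgroup G H \<longleftrightarrow>
    subgroup H G \<and> (\<forall>u\<in>carrier G. \<forall>n::int. n \<noteq> 0 \<longrightarrow> u [^]\<^bsub>G\<^esub> n \<in> H \<longrightarrow> u \<in> H)"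

context comm_group
begin

lemma finprod_insert2:
  assumes "finite I" "i \<in> I" "j \<in> I" "i \<noteq> j" "f \<in> I \<rightarrow> carrier G"
  shows "finprod G f I = f i \<otimes> (f j \<otimes> finprod G f (I - {i, j}))"
proof -
  have "I = insert i (insert j (I - {i, j}))" using assms by auto
  then have "finprod G f I = finprod G f (insert i (insert j (I - {i, j})))" by simp
  also have "\<dots> = f i \<otimes> (f j \<otimes> finprod G f (I - {i, j}))"
    using assms by (simp add: Pi_iff)
  finally show ?thesis .
qed

lemma generate_Un_cong:
  assumes "generate G A = generate G A'" "A \<subseteq> carrier G" "A' \<subseteq> carrier G" "C \<subseteq> carrier G"
  shows "generate G (A \<union> C) = generate G (A' \<union> C)"
proof -
  have *: "generate G (X \<union> C) \<subseteq> generate G (Y \<union> C)"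
    if "generate G X = generate G Y" "X \<subseteq> carrier G" "Y \<subseteq> carrier G" for X Y
  proof (rule generate_subgroup_incl)
    have "X \<subseteq> generate G Y" using that(1) generate.incl[of _ X G] by auto
    also have "\<dots> \<subseteq> generate G (Y \<union> C)" by (intro mono_generate) auto
    finally show "X \<union> C \<subseteq> generate G (Y \<union> C)" using generate.incl[of _ "Y \<union> C" G] by auto
    show "subgroup (generate G (Y \<union> C)) G" by (intro generate_is_subgroup) (use that assms in auto)
  qed
  show ?thesis using *[of A A'] *[of A' A] assms by auto
qed

text \<open>The substitution at \<open>j\<close> is undone by the exponent \<open>- e\<close>,
  because \<open>a i\<close> itself is unchanged (\<open>i\<close> differs from \<open>j\<close>).
  So each family lies in the subgroup generated by the other.\<close>

lemma generate_transvection: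
  assumes "a \<in> I \<rightarrow> carrier G" "i \<in> I" "j \<in> I" "i \<noteq> j"
  shows "generate G ((a(j := a j \<otimes> a i [^] (e::int))) ` I) = generate G (a ` I)"
proof -
  let ?b = "a(j := a j \<otimes> a i [^] e)"
  have ac: "a k \<in> carrier G" if "k \<in> I" for k using assms that by auto
  have bc: "?b k \<in> carrier G" if "k \<in> I" for k using ac assms that by auto
  have sa: "subgroup (generate G (a ` I)) G" by (intro generate_is_subgroup) (use ac in auto)
  have sb: "subgroup (generate G (?b ` I)) G" by (intro generate_is_subgroup) (use bc in blast)
  have ga: "a k \<in> generate G (a ` I)" if "k \<in> I" for k using that by (auto intro: generate.incl)
  have gb: "?b k \<in> generate G (?b ` I)" if "k \<in> I" for k using that by (intro generate.incl imageI)
  have 1: "?b k \<in> generate G (a ` I)" if "k \<in> I" for k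
    using ga that assms subgroup_int_pow_closed[OF sa] subgroup.m_closed[OF sa] by auto
  have "a i \<in> generate G (?b ` I)" using gb[of i] assms by auto
  then have "(a j \<otimes> a i [^] e) \<otimes> a i [^] (- e) \<in> generate G (?b ` I)"
    using gb[of j] assms subgroup_int_pow_closed[OF sb] subgroup.m_closed[OF sb] by auto
  moreover have "(a j \<otimes> a i [^] e) \<otimes> a i [^] (- e) = a j"
    using ac assms by (simp add: m_assoc int_pow_neg)
  ultimately have aj: "a j \<in> generate G (?b ` I)" by simp
  have 2: "a k \<in> generate G (?b ` I)" if "k \<in> I" for k
    using gb[of k] aj that by (cases "k = j") auto
  show ?thesis
    using generate_subgroup_incl[OF _ sa, of "?b ` I"] generate_subgroup_incl[OF _ sb, of "a ` I"] 1 2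
    by blast
qed

text \<open>The Euclidean algorithm on the exponents of a nontrivial relation modulo a pure subgroup
  moves one of the generators into that subgroup.\<close>

lemma pure_subgroup_relation_imp_generator:
  fixes a :: "'i \<Rightarrow> 'a" and c :: "'i \<Rightarrow> int"
  assumes H: "pure_subgroup G H" and I: "finite I"
    and "a \<in> I \<rightarrow> carrier G" "(\<Otimes>i\<in>I. a i [^] c i) \<in> H" "\<exists>i\<in>I. c i \<noteq> 0"
  shows "\<exists>b\<in>I \<rightarrow> carrier G. generate G (b ` I) = generate G (a ` I) \<and> (\<exists>j\<in>I. b j \<in> H)"
  using assms(3-5)
proof (induction "nat (\<Sum>i\<in>I. \<bar>c i\<bar>)" arbitrary: a c rule: less_induct)
  case (less c a)
  have ac: "a k \<in> carrier G" if "k \<in> I" for k using less.prems(1) that by auto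
  obtain i0 where i0: "i0 \<in> I" "c i0 \<noteq> 0" using less.prems by blast
  show ?case
  proof (cases "\<forall>j\<in>I. j \<noteq> i0 \<longrightarrow> c j = 0")
    case True
    have "(\<Otimes>i\<in>I. a i [^] c i) = (\<Otimes>i\<in>I. if i0 = i then a i [^] c i else \<one>)"
      using ac True by (intro finprod_cong) (auto simp: simp_implies_def)
    also have "\<dots> = a i0 [^] c i0"
      by (rule finprod_singleton) (use i0 ac I in auto)
    \<comment> \<open>The relation is a nonzero power of the single generator \<open>a i0\<close>,
      so purity applies.\<close>
    finally have "a i0 \<in> H" using less.prems(2) H i0 ac unfolding pure_subgroup_def by auto
    then show ?thesis using less.prems(1) i0 by blast
  next
    case False
    then obtain j0 where j0: "j0 \<in> I" "j0 \<noteq> i0" "c j0 \<noteq> 0" by blast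
    obtain i j where ij: "i \<in> I" "j \<in> I" "i \<noteq> j" "c i \<noteq> 0" "c j \<noteq> 0" "\<bar>c j\<bar> \<le> \<bar>c i\<bar>"
      using i0 j0 by (metis linear)
    \<comment> \<open>With this sign \<open>e * c j\<close> has the sign of \<open>c i\<close> and
      is at most as large, so subtracting it lowers the absolute value of
      \<open>c i\<close>.\<close>
    define e where "e = sgn (c i) * sgn (c j)"
    define b where "b = a(j := a j \<otimes> a i [^] e)"
    \<comment> \<open>Writing the relation with \<open>b j\<close> in place of \<open>a j\<close>
      contributes an extra \<open>e * c j\<close> to the exponent of \<open>a i\<close>;
      \<open>d\<close> subtracts it, so the product stays the same.\<close>
    define d where "d = c(i := c i - e * c j)"
    have bc: "b \<in> I \<rightarrow> carrier G" using ac ij by (auto simp: b_def)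
    have abs: "\<bar>c i - e * c j\<bar> < \<bar>c i\<bar>"
      using ij by (auto simp: e_def sgn_if abs_if split: if_splits)
    have "(\<Otimes>k\<in>I. b k [^] d k) = b i [^] d i \<otimes> (b j [^] d j \<otimes> (\<Otimes>k\<in>I - {i, j}. b k [^] d k))"
      using ij I bc by (intro finprod_insert2) (auto intro!: int_pow_closed)
    also have "(\<Otimes>k\<in>I - {i, j}. b k [^] d k) = (\<Otimes>k\<in>I - {i, j}. a k [^] c k)"
      using ac by (intro finprod_cong) (auto simp: simp_implies_def b_def d_def)
    also have "b i [^] d i \<otimes> (b j [^] d j \<otimes> (\<Otimes>k\<in>I - {i, j}. a k [^] c k)) =
        a i [^] c i \<otimes> (a j [^] c j \<otimes> (\<Otimes>k\<in>I - {i, j}. a k [^] c k))"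
    proof -
      have P: "(\<Otimes>k\<in>I - {i, j}. a k [^] c k) \<in> carrier G" using ac by (intro finprod_closed) auto
      have "b i [^] d i \<otimes> b j [^] d j = a i [^] (c i - e * c j) \<otimes> (a j \<otimes> a i [^] e) [^] c j"
        using ij by (simp add: b_def d_def)
      also have "\<dots> = a i [^] (c i - e * c j) \<otimes> (a i [^] (e * c j) \<otimes> a j [^] c j)"
        using ac ij by (simp add: int_pow_distrib int_pow_pow m_comm)
      also have "\<dots> = a i [^] (c i - e * c j + e * c j) \<otimes> a j [^] c j"
        using ac ij by (subst int_pow_mult) (auto simp: m_assoc)
      finally have "b i [^] d i \<otimes> b j [^] d j = a i [^] c i \<otimes> a j [^] c j" by simp
      moreover have "b i \<in> carrier G" "b j \<in> carrier G" using bc ij by auto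
      ultimately show ?thesis using P ac ij by (simp add: m_assoc[symmetric])
    qed
    also have "\<dots> = (\<Otimes>k\<in>I. a k [^] c k)"
      using ij I ac by (intro finprod_insert2[symmetric]) auto
    finally have rel: "(\<Otimes>k\<in>I. b k [^] d k) \<in> H" using less.prems by simp
    have "(\<Sum>k\<in>I. \<bar>d k\<bar>) < (\<Sum>k\<in>I. \<bar>c k\<bar>)"
    proof (rule sum_strict_mono_ex1)
      show "\<forall>k\<in>I. \<bar>d k\<bar> \<le> \<bar>c k\<bar>" using abs by (auto simp: d_def)
      show "\<exists>k\<in>I. \<bar>d k\<bar> < \<bar>c k\<bar>" using abs ij by (intro bexI[of _ i]) (auto simp: d_def)
    qed (rule I)
    moreover have "0 \<le> (\<Sum>k\<in>I. \<bar>d k\<bar>)" by (intro sum_nonneg) auto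
    ultimately have "nat (\<Sum>k\<in>I. \<bar>d k\<bar>) < nat (\<Sum>k\<in>I. \<bar>c k\<bar>)" by linarith
    \<comment> \<open>The exponent at \<open>j\<close> is untouched and nonzero, so the smaller
      relation is still nontrivial.\<close>
    moreover have "\<exists>k\<in>I. d k \<noteq> 0" using ij by (intro bexI[of _ j]) (auto simp: d_def)
    ultimately have "\<exists>b'\<in>I \<rightarrow> carrier G. generate G (b' ` I) = generate G (b ` I) \<and> (\<exists>j\<in>I. b' j \<in> H)"
      using less.hyps bc rel by blast
    moreover have "generate G (b ` I) = generate G (a ` I)"
      unfolding b_def by (rule generate_transvection) (use less.prems ij in auto)
    ultimately show ?thesis by simp
  qed
qed

text \<open>For finite \<open>J\<close>, this is linear independence over the integers of the images
  of the \<open>b j\<close> in the quotient by \<open>H\<close>, phrased without forming that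
  quotient.\<close>

definition independent_mod :: "'a set \<Rightarrow> ('i \<Rightarrow> 'a) \<Rightarrow> 'i set \<Rightarrow> bool"
  where "independent_mod H b J \<longleftrightarrow>
    (\<forall>c::'i \<Rightarrow> int. (\<Otimes>j\<in>J. b j [^] c j) \<in> H \<longrightarrow> (\<forall>j\<in>J. c j = 0))"

text \<open>As long as the family is dependent modulo \<open>H\<close>, the preceding lemma moves
  one generator into \<open>H\<close>. That index is set aside and the argument is repeated for the
  others; the indices that remain form \<open>J\<close>.\<close>

lemma adapted_generators:
  fixes a :: "'i \<Rightarrow> 'a"
  assumes H: "pure_subgroup G H" and I: "finite I" and "a \<in> I \<rightarrow> carrier G"
  shows "\<exists>b\<in>I \<rightarrow> carrier G. \<exists>J\<subseteq>I. generate G (b ` I) = generate G (a ` I) \<and>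
           b ` (I - J) \<subseteq> H \<and> independent_mod H b J"
  using assms(2,3)
proof (induction "card I" arbitrary: I a rule: less_induct)
  case less
  show ?case
  proof (cases "independent_mod H a I")
    case True
    then show ?thesis using less.prems by (intro bexI[of _ a] exI[of _ I]) auto
  next
    case False
    then obtain c :: "'i \<Rightarrow> int" where "(\<Otimes>i\<in>I. a i [^] c i) \<in> H" "\<exists>i\<in>I. c i \<noteq> 0"
      by (auto simp: independent_mod_def)
    from pure_subgroup_relation_imp_generator[OF H less.prems this] obtain b j where
      b: "b \<in> I \<rightarrow> carrier G" "generate G (b ` I) = generate G (a ` I)" "j \<in> I" "b j \<in> H" by auto
    define I' where "I' = I - {j}"
    have "card I' < card I" unfolding I'_def by (rule card_Diff1_less) (use b less.prems in auto)
    moreover have "finite I'" "b \<in> I' \<rightarrow> carrier G" using b less.prems by (auto simp: I'_def)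
    ultimately obtain d J where
      d: "d \<in> I' \<rightarrow> carrier G" "J \<subseteq> I'" "generate G (d ` I') = generate G (b ` I')"
        "d ` (I' - J) \<subseteq> H" "independent_mod H d J"
      using less.hyps[of I' b] by blast
    \<comment> \<open>The generator set aside is put back at \<open>j\<close>. It lies in
      \<open>H\<close>, and \<open>j\<close> is not in \<open>J\<close>, so independence is not
      affected.\<close>
    define d' where "d' = d(j := b j)"
    have I: "I = insert j I'" "j \<notin> I'" using b by (auto simp: I'_def)
    have im: "d' ` I' = d ` I'" using I by (auto simp: d'_def)
    have "generate G (d' ` I) = generate G (d ` I' \<union> {b j})"
      using im by (simp add: I(1)) (simp add: d'_def)
    also have "\<dots> = generate G (b ` I' \<union> {b j})"
      by (rule generate_Un_cong[OF d(3)]) (use b d I in auto)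
    finally have 1: "generate G (d' ` I) = generate G (a ` I)" using b(2) I by simp
    have 2: "d' \<in> I \<rightarrow> carrier G" using d(1) b by (auto simp: d'_def I'_def)
    have 3: "d' ` (I - J) \<subseteq> H" using d b by (auto simp: d'_def I'_def)
    have "d' k = d k" if "k \<in> J" for k using that d(2) I by (auto simp: d'_def)
    then have "(\<Otimes>k\<in>J. d' k [^] z k) = (\<Otimes>k\<in>J. d k [^] z k)" for z :: "'i \<Rightarrow> int"
      using d(1,2) by (intro finprod_cong) (auto simp: simp_implies_def intro!: int_pow_closed)
    then have 4: "independent_mod H d' J" using d(5) by (simp add: independent_mod_def)
    have "J \<subseteq> I" using d(2) I by auto
    then show ?thesis using 1 2 3 4 by (intro bexI[of _ d'] exI[of _ J] conjI) auto
  qed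
qed

lemma finprod_int_pow_add:
  assumes "b \<in> J \<rightarrow> carrier G"
  shows "(\<Otimes>j\<in>J. b j [^] (c j + d j :: int)) = (\<Otimes>j\<in>J. b j [^] c j) \<otimes> (\<Otimes>j\<in>J. b j [^] d j)"
proof -
  have "(\<Otimes>j\<in>J. b j [^] (c j + d j)) = (\<Otimes>j\<in>J. b j [^] c j \<otimes> b j [^] d j)"
    using assms by (intro finprod_cong) (auto simp: simp_implies_def int_pow_mult Pi_iff)
  also have "\<dots> = (\<Otimes>j\<in>J. b j [^] c j) \<otimes> (\<Otimes>j\<in>J. b j [^] d j)"
    using assms by (intro finprod_multf) (auto simp: Pi_iff)
  finally show ?thesis .
qed

text \<open>Commutativity allows the factors from \<open>b\<close> and those from \<open>C\<close>
  in a word to be collected separately.\<close>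

lemma generate_image_Un:
  assumes "finite J" "b \<in> J \<rightarrow> carrier G" "C \<subseteq> carrier G" "x \<in> generate G (b ` J \<union> C)"
  shows "\<exists>c::'i \<Rightarrow> int. \<exists>v\<in>generate G C. x = (\<Otimes>j\<in>J. b j [^] c j) \<otimes> v"
  using assms(4)
proof (induction rule: generate.induct)
  have gc: "generate G C \<subseteq> carrier G" using assms by (intro generate_incl)
  have pc: "(\<Otimes>j\<in>J. b j [^] c j) \<in> carrier G" for c :: "'i \<Rightarrow> int"
    using assms by (intro finprod_closed) auto
  have single: "(\<Otimes>j\<in>J. b j [^] (if k = j then n else 0 :: int)) = b k [^] n" if "k \<in> J" for k n
  proof -
    have "(\<Otimes>j\<in>J. b j [^] (if k = j then n else 0)) = (\<Otimes>j\<in>J. if k = j then b j [^] n else \<one>)"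
      using assms by (intro finprod_cong) (auto simp: simp_implies_def)
    also have "\<dots> = b k [^] n" by (rule finprod_singleton) (use assms that in auto)
    finally show ?thesis .
  qed
  have zero: "(\<Otimes>j\<in>J. b j [^] (0::int)) = \<one>" by simp
  {
    case one
    show ?case using zero generate.one[of G C] by (intro exI[of _ "\<lambda>_. 0"] bexI[of _ \<one>]) auto
  next
    case (incl h)
    show ?case
    proof (cases "h \<in> C")
      case True
      then show ?thesis using generate.incl[of h C G] gc
        by (intro exI[of _ "\<lambda>_. 0"] bexI[of _ h]) (auto simp: zero)
    next
      case False
      then obtain k where k: "k \<in> J" "h = b k" using incl by auto
      then show ?thesis using single[OF k(1), of 1] generate.one[of G C] assms(2)
        by (intro exI[of _ "\<lambda>j. if k = j then 1 else 0"] bexI[of _ \<one>]) (auto simp: Pi_iff)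
    qed
  next
    case (inv h)
    show ?case
    proof (cases "h \<in> C")
      case True
      then show ?thesis using generate.inv[of h C G] gc
        by (intro exI[of _ "\<lambda>_. 0"] bexI[of _ "inv h"]) (auto simp: zero)
    next
      case False
      then obtain k where k: "k \<in> J" "h = b k" using inv by auto
      then show ?thesis using single[OF k(1), of "-1"] generate.one[of G C] assms(2)
        by (intro exI[of _ "\<lambda>j. if k = j then -1 else 0"] bexI[of _ \<one>]) (auto simp: Pi_iff int_pow_neg)
    qed
  next
    case (eng h1 h2)
    then obtain c d v w where
      "v \<in> generate G C" "h1 = (\<Otimes>j\<in>J. b j [^] (c j::int)) \<otimes> v"
      "w \<in> generate G C" "h2 = (\<Otimes>j\<in>J. b j [^] (d j::int)) \<otimes> w" by blast
    moreover from this have "v \<in> carrier G" "w \<in> carrier G" using gc by auto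
    ultimately show ?case using finprod_int_pow_add[OF assms(2), of c d] pc[of c] pc[of d]
      by (intro exI[of _ "\<lambda>j. c j + d j"] bexI[of _ "v \<otimes> w"]) (auto simp: m_ac intro: generate.eng)
  }
qed

text \<open>The cosets of the \<open>b j\<close> form a basis of the quotient: they span because
  \<open>C\<close> vanishes modulo \<open>H\<close>, and they are independent by assumption.\<close>

lemma FactGroup_iso_free:
  fixes b :: "'i \<Rightarrow> 'a"
  assumes H: "subgroup H G" and J: "finite J" "b \<in> J \<rightarrow> carrier G"
    and ind: "independent_mod H b J" and C: "C \<subseteq> H" and gen: "generate G (b ` J \<union> C) = carrier G"
  shows "free_abelian (G Mod H)"
proof -
  interpret H: subgroup H G by (rule H)
  interpret N: normal H G using H by (simp add: normal_iff_subgroup)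
  interpret Q: comm_group "G Mod H" by (rule abelian_FactGroup[OF H])
  have pc: "(\<Otimes>j\<in>J. b j [^] c j) \<in> carrier G" for c :: "'i \<Rightarrow> int"
    using J by (intro finprod_closed) auto
  \<comment> \<open>The basis consists of cosets rather than of indices, since
    \<open>free_abelian\<close> asks for a basis of the element type of the quotient. Injectivity
    then transports exponents between \<open>J\<close> and the set of cosets.\<close>
  define \<beta> where "\<beta> = (\<lambda>j. H #> b j)"
  have inj: "inj_on \<beta> J"
  proof (rule inj_onI, rule ccontr)
    fix i j assume ij: "i \<in> J" "j \<in> J" "\<beta> i = \<beta> j" "i \<noteq> j"
    \<comment> \<open>Equal cosets would make these exponents 1 and -1 a nontrivial relation modulo
      \<open>H\<close>.\<close>
    define c where "c = (\<lambda>k. if k = i then 1 else if k = j then -1 else 0 :: int)"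
    have "(\<Otimes>k\<in>J. b k [^] c k) = b i [^] c i \<otimes> (b j [^] c j \<otimes> (\<Otimes>k\<in>J - {i, j}. b k [^] c k))"
      using ij J by (intro finprod_insert2) (auto simp: c_def)
    also have "(\<Otimes>k\<in>J - {i, j}. b k [^] c k) = \<one>" by (intro finprod_one_eqI) (auto simp: c_def)
    also have "b i [^] c i \<otimes> (b j [^] c j \<otimes> \<one>) = b i \<otimes> inv (b j)"
      using ij J by (auto simp: c_def int_pow_neg Pi_iff)
    finally have "(\<Otimes>k\<in>J. b k [^] c k) = b i \<otimes> inv (b j)" .
    moreover have "b i \<in> H #> b j"
      using ij J rcos_self[OF _ H, of "b i"] by (auto simp: \<beta>_def Pi_iff)
    then have "b i \<otimes> inv (b j) \<in> H" using ij J by (intro H.rcos_module_imp is_group) auto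
    ultimately have "c i = 0" using ind ij by (auto simp: independent_mod_def)
    then show False by (simp add: c_def)
  qed
  \<comment> \<open>A formal combination of cosets is evaluated on the representatives
    \<open>b j\<close>; \<open>k\<close> is this evaluation followed by the quotient map.\<close>
  define h where "h = (\<lambda>p :: 'a set \<Rightarrow>\<^sub>0 int. \<Otimes>j\<in>J. b j [^] Poly_Mapping.lookup p (\<beta> j))"
  have hc: "h p \<in> carrier G" for p unfolding h_def by (rule pc)
  have h_add: "h (p + q) = h p \<otimes> h q" for p q
    unfolding h_def lookup_add by (rule finprod_int_pow_add[OF J(2)])
  define k where "k = (\<lambda>p. H #> h p)"
  have "k \<in> hom (free_Abelian_group (\<beta> ` J)) (G Mod H)"
    by (rule homI) (auto simp: k_def carrier_FactGroup hc h_add N.rcos_sum)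
  then interpret k: group_hom "free_Abelian_group (\<beta> ` J)" "G Mod H" k
    by (simp add: group_hom_def group_hom_axioms_def Q.group_axioms)
  have "k p = \<one>\<^bsub>G Mod H\<^esub> \<longrightarrow> p = \<one>\<^bsub>free_Abelian_group (\<beta> ` J)\<^esub>"
    if "p \<in> carrier (free_Abelian_group (\<beta> ` J))" for p
  proof
    assume p: "k p = \<one>\<^bsub>G Mod H\<^esub>"
    then have "H #> h p = H" by (simp add: k_def)
    then have "h p \<in> H" using hc by (metis rcos_self H)
    then have "\<forall>j\<in>J. Poly_Mapping.lookup p (\<beta> j) = 0"
      using ind[unfolded independent_mod_def, rule_format, of "\<lambda>j. Poly_Mapping.lookup p (\<beta> j)"]
      unfolding h_def by auto
    then have "Poly_Mapping.lookup p t = 0" for t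
      using that by (auto simp: in_keys_iff subset_iff)
    then have "p = 0" by (intro poly_mapping_eqI) simp
    then show "p = \<one>\<^bsub>free_Abelian_group (\<beta> ` J)\<^esub>" by simp
  qed
  moreover have "carrier (G Mod H) \<subseteq> k ` carrier (free_Abelian_group (\<beta> ` J))"
  proof
    fix X assume "X \<in> carrier (G Mod H)"
    then obtain x where x: "x \<in> carrier G" "X = H #> x" by (auto simp: carrier_FactGroup)
    have "C \<subseteq> carrier G" using C by auto
    then obtain c v where cv: "v \<in> generate G C" "x = (\<Otimes>j\<in>J. b j [^] (c j::int)) \<otimes> v"
      using generate_image_Un[OF J, of C x] gen x by blast
    have vH: "v \<in> H" using generate_subgroup_incl[OF C H] cv by auto
    define d where "d = c \<circ> the_inv_into J \<beta>"
    have d: "d (\<beta> j) = c j" if "j \<in> J" for j using that inj by (simp add: d_def the_inv_into_f_f)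
    \<comment> \<open>The coefficient at the coset \<open>\<beta> j\<close> is \<open>c j\<close>.
      Being zero off the finite image of \<open>J\<close>, the function has finite support, as the
      abstraction requires.\<close>
    define p where "p = Poly_Mapping.Abs_poly_mapping (\<lambda>y. if y \<in> \<beta> ` J then d y else 0)"
    have lp: "Poly_Mapping.lookup p = (\<lambda>y. if y \<in> \<beta> ` J then d y else 0)"
      unfolding p_def using J(1) by (intro Abs_poly_mapping_inverse) auto
    have "h p = (\<Otimes>j\<in>J. b j [^] c j)"
      unfolding h_def lp using J(2) by (intro finprod_cong) (auto simp: simp_implies_def d)
    then have "X = H #> (v \<otimes> h p)" using x cv vH hc[of p] by (simp add: m_comm)
    also have "\<dots> = H #> h p"
      using vH hc[of p] by (metis H coset_join2 coset_mult_assoc H.mem_carrier H.subset)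
    finally have "X = k p" by (simp add: k_def)
    moreover have "Poly_Mapping.keys p \<subseteq> \<beta> ` J" by (auto simp: in_keys_iff lp split: if_splits)
    ultimately show "X \<in> k ` carrier (free_Abelian_group (\<beta> ` J))" by auto
  qed
  ultimately have "k \<in> iso (free_Abelian_group (\<beta> ` J)) (G Mod H)"
    unfolding k.iso_iff by blast
  then have "free_Abelian_group (\<beta> ` J) \<cong> G Mod H" by (rule is_isoI)
  then have "G Mod H \<cong> free_Abelian_group (\<beta> ` J)" by (simp add: group.iso_sym)
  then show ?thesis unfolding free_abelian_def by blast
qed

text \<open>Adapted generators split into a part indexed by \<open>J\<close>, whose cosets form a
  basis of the quotient, and a part \<open>C\<close> inside \<open>H\<close>, which generates
  \<open>H\<close>. If \<open>H\<close> is proper, then \<open>J\<close> is nonempty and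
  \<open>C\<close> is smaller than \<open>A\<close>; this strict drop drives the induction in the
  converse.\<close>

lemma pure_subgroup_structure:
  assumes H: "pure_subgroup G H" and A: "finite A" "A \<subseteq> carrier G" "generate G A = carrier G"
  shows "saturated G H"
    and "\<exists>C. finite C \<and> C \<subseteq> H \<and> generate G C = H \<and> card C \<le> card A \<and>
           (H \<noteq> carrier G \<longrightarrow> card C < card A)"
proof -
  have sH: "subgroup H G" using H by (simp add: pure_subgroup_def)
  have "id \<in> A \<rightarrow> carrier G" using A by auto
  from adapted_generators[OF H A(1) this] obtain b J where
    b: "b \<in> A \<rightarrow> carrier G" "J \<subseteq> A" "generate G (b ` A) = carrier G" "b ` (A - J) \<subseteq> H"
      "independent_mod H b J" using A by auto
  have J: "finite J" "b \<in> J \<rightarrow> carrier G" using b A finite_subset by auto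
  define C where "C = b ` (A - J)"
  have "b ` A = b ` J \<union> C" using b by (auto simp: C_def)
  then have gen: "generate G (b ` J \<union> C) = carrier G" using b by simp
  have C: "C \<subseteq> H" using b by (simp add: C_def)
  show "saturated G H"
    using FactGroup_iso_free[OF sH J b(5) C gen] sH by (simp add: saturated_def)
  have gC: "generate G C = H"
  proof
    show "generate G C \<subseteq> H" by (rule generate_subgroup_incl[OF C sH])
    show "H \<subseteq> generate G C"
    proof
      fix x assume x: "x \<in> H"
      have cc: "C \<subseteq> carrier G" using C subgroup.subset[OF sH] by auto
      then obtain c v where cv: "v \<in> generate G C" "x = (\<Otimes>j\<in>J. b j [^] (c j::int)) \<otimes> v"
        using generate_image_Un[OF J, of C x] gen x subgroup.subset[OF sH] by blast
      have pc: "(\<Otimes>j\<in>J. b j [^] c j) \<in> carrier G" using J by (intro finprod_closed) auto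
      have v: "v \<in> H" "v \<in> carrier G"
        using cv generate_subgroup_incl[OF C sH] subgroup.subset[OF sH] by auto
      \<comment> \<open>Dividing by \<open>v\<close> shows that the factor indexed by
        \<open>J\<close> lies in \<open>H\<close>, so independence makes all its exponents
        zero.\<close>
      have "(\<Otimes>j\<in>J. b j [^] c j) = x \<otimes> inv v" using cv pc v by (simp add: m_assoc)
      also have "\<dots> \<in> H" using x v sH by (simp add: subgroup.m_closed subgroup.m_inv_closed)
      finally have "\<forall>j\<in>J. c j = 0" using b(5) unfolding independent_mod_def by blast
      then have "(\<Otimes>j\<in>J. b j [^] c j) = \<one>" by (intro finprod_one_eqI) auto
      then show "x \<in> generate G C" using cv v by simp
    qed
  qed
  have "card C \<le> card (A - J)" unfolding C_def by (rule card_image_le) (use A in auto)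
  also have "\<dots> = card A - card J" by (rule card_Diff_subset) (use b J in auto)
  finally have le: "card C \<le> card A - card J" .
  moreover have "card C < card A" if "H \<noteq> carrier G"
  proof -
    have "J \<noteq> {}"
    proof
      assume "J = {}"
      then have "b ` J \<union> C = C" by auto
      then show False using gen gC that by metis
    qed
    then have "0 < card J" "card J \<le> card A"
      using J b(2) A(1) by (auto simp: card_gt_0_iff intro: card_mono)
    then show ?thesis using le by linarith
  qed
  ultimately show "\<exists>C. finite C \<and> C \<subseteq> H \<and> generate G C = H \<and> card C \<le> card A \<and>
           (H \<noteq> carrier G \<longrightarrow> card C < card A)"
    using C gC A by (intro exI[of _ C]) (auto simp: C_def)
qed

end

section \<open>Homomorphisms to the reals from ordered abelian groups\<close>

text \<open>\<open>N\<close> is the set of nonnegative elements of a translation-invariant total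
  preorder on \<open>G\<close>, where \<open>v\<close> is above \<open>u\<close> when
  \<open>inv u \<otimes> v\<close> is in \<open>N\<close>. Antisymmetry is not assumed, so
  \<open>N\<close> may contain an element together with its inverse.\<close>

locale group_cone = comm_group G for G (structure) +
  fixes N
  assumes N_carrier: "N \<subseteq> carrier G"
    and N_mult: "\<And>u v. u \<in> N \<Longrightarrow> v \<in> N \<Longrightarrow> u \<otimes> v \<in> N"
    and N_total: "\<And>u. u \<in> carrier G \<Longrightarrow> u \<in> N \<or> inv u \<in> N"
begin

lemma N_closed: "u \<in> N \<Longrightarrow> u \<in> carrier G"
  using N_carrier by auto

lemma N_one: "\<one> \<in> N"
  using N_total[of \<one>] by auto

lemma N_pow: "u \<in> N \<Longrightarrow> 0 \<le> n \<Longrightarrow> u [^] (n::int) \<in> N"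
proof -
  have "u [^] k \<in> N" if "u \<in> N" for k :: nat
    by (induction k) (use that N_one N_mult in auto)
  then show "u \<in> N \<Longrightarrow> 0 \<le> n \<Longrightarrow> u [^] n \<in> N"
    by (metis int_pow_int nonneg_int_cases)
qed

lemma ex_upper_bound:
  assumes "finite A" "A \<subseteq> carrier G"
  shows "\<exists>m\<in>N. \<forall>a\<in>A. m \<otimes> a \<in> N \<and> m \<otimes> inv a \<in> N"
  using assms
proof (induction A rule: finite_induct)
  case empty
  then show ?case using N_one by auto
next
  case (insert a A)
  then obtain m where m: "m \<in> N" "\<forall>b\<in>A. m \<otimes> b \<in> N \<and> m \<otimes> inv b \<in> N" by auto
  have a: "a \<in> carrier G" using insert.prems by auto
  \<comment> \<open>This is the absolute value of \<open>a\<close>: multiplied by \<open>a\<close>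
    or by \<open>inv a\<close> it gives either the identity or its own square.\<close>
  define c where "c = (if a \<in> N then a else inv a)"
  have c: "c \<in> N" using N_total[OF a] by (auto simp: c_def)
  have "c \<otimes> a \<in> N \<and> c \<otimes> inv a \<in> N"
    using c a N_mult[OF c c] N_one by (auto simp: c_def split: if_splits)
  then have "m \<otimes> (c \<otimes> a) \<in> N" "m \<otimes> (c \<otimes> inv a) \<in> N" using m N_mult by auto
  moreover have "m \<otimes> (c \<otimes> b) = c \<otimes> (m \<otimes> b)" if "b \<in> carrier G" for b
    using that c m N_closed by (intro m_lcomm) auto
  then have "m \<otimes> (c \<otimes> b) \<in> N \<and> m \<otimes> (c \<otimes> inv b) \<in> N" if "b \<in> A" for b
    using that c m insert.prems N_mult by auto
  ultimately have "m \<otimes> (c \<otimes> b) \<in> N \<and> m \<otimes> (c \<otimes> inv b) \<in> N" if "b \<in> insert a A" for b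
    using that by blast
  then have "\<forall>b\<in>insert a A. m \<otimes> c \<otimes> b \<in> N \<and> m \<otimes> c \<otimes> inv b \<in> N"
    using c m N_closed insert.prems by (auto simp: m_assoc)
  then show ?case using c m N_mult by blast
qed

text \<open>An upper bound \<open>m\<close> of finitely many generators and their inverses suffices:
  along a word in the generators the required exponents of \<open>m\<close> add up.\<close>

lemma ex_order_unit:
  assumes "finitely_generated_group G"
  shows "\<exists>m\<in>N. \<forall>v\<in>carrier G. \<exists>n\<ge>0. m [^] (n::int) \<otimes> v \<in> N \<and> m [^] n \<otimes> inv v \<in> N"
proof -
  obtain A where A: "finite A" "A \<subseteq> carrier G" "generate G A = carrier G"
    using assms by (auto simp: finitely_generated_group_def)
  obtain m where m: "m \<in> N" "\<forall>a\<in>A. m \<otimes> a \<in> N \<and> m \<otimes> inv a \<in> N"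
    using ex_upper_bound[OF A(1,2)] by auto
  have mc: "m \<in> carrier G" using m N_closed by auto
  have "\<exists>n\<ge>0. m [^] (n::int) \<otimes> v \<in> N \<and> m [^] n \<otimes> inv v \<in> N" if "v \<in> generate G A" for v
    using that
  proof (induction rule: generate.induct)
    case one
    then show ?case using N_one by (intro exI[of _ 0]) auto
  next
    case (incl h)
    then show ?case using m mc by (intro exI[of _ 1]) auto
  next
    case (inv h)
    then show ?case using m mc A(2) by (intro exI[of _ 1]) (auto simp: subset_iff)
  next
    case (eng h k)
    then obtain n p where np: "n \<ge> 0" "m [^] (n::int) \<otimes> h \<in> N" "m [^] n \<otimes> inv h \<in> N"
      "p \<ge> 0" "m [^] (p::int) \<otimes> k \<in> N" "m [^] p \<otimes> inv k \<in> N" by blast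
    have hk: "h \<in> carrier G" "k \<in> carrier G" using eng A by auto
    have "m [^] (n + p) \<otimes> (h \<otimes> k) = (m [^] n \<otimes> h) \<otimes> (m [^] p \<otimes> k)"
      "m [^] (n + p) \<otimes> inv (h \<otimes> k) = (m [^] n \<otimes> inv h) \<otimes> (m [^] p \<otimes> inv k)"
      using hk mc by (simp_all add: int_pow_mult m_ac inv_mult)
    then show ?case using np N_mult by (intro exI[of _ "n + p"]) auto
  qed
  then show ?thesis using m A by auto
qed

text \<open>Hoelder: \<open>f v\<close> is the supremum of all \<open>p / q\<close> such that \<open>v\<close> to the power \<open>q\<close> is at least
  the order unit to the power \<open>p\<close>.\<close>

theorem ex_monotone_hom:
  assumes fg: "finitely_generated_group G" and proper: "N \<noteq> carrier G"
  shows "\<exists>f. f \<in> hom G real_group \<and> (\<forall>u\<in>N. 0 \<le> f u) \<and> (\<exists>u\<in>carrier G. f u \<noteq> 0)"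
proof -
  obtain m where m: "m \<in> N"
    and bnd: "\<And>v. v \<in> carrier G \<Longrightarrow> \<exists>n\<ge>0. m [^] (n::int) \<otimes> v \<in> N \<and> m [^] n \<otimes> inv v \<in> N"
    using ex_order_unit[OF fg] by blast
  have mc: "m \<in> carrier G" using m N_closed by auto
  \<comment> \<open>Otherwise all powers of \<open>m\<close> would be nonnegative, and so would
    every element, since each dominates some power of \<open>m\<close>.\<close>
  have inv_m: "inv m \<notin> N"
  proof
    assume *: "inv m \<in> N"
    have "v \<in> N" if v: "v \<in> carrier G" for v
    proof -
      obtain n where n: "n \<ge> 0" "m [^] (n::int) \<otimes> v \<in> N" using bnd[OF v] by auto
      have "(inv m) [^] n \<otimes> (m [^] n \<otimes> v) \<in> N" using N_mult[OF N_pow[OF *]] n by auto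
      moreover have "(inv m) [^] n \<otimes> (m [^] n \<otimes> v) = v"
        using mc v by (simp add: int_pow_inv m_assoc[symmetric])
      ultimately show ?thesis by simp
    qed
    then show False using proper N_carrier by auto
  qed
  \<comment> \<open>If \<open>k\<close> were negative, multiplying by the nonnegative power with
    exponent \<open>- k - 1\<close> would put \<open>inv m\<close> into \<open>N\<close>.\<close>
  have neg: "0 \<le> k" if "m [^] (k::int) \<in> N" for k
  proof (rule ccontr)
    assume "\<not> 0 \<le> k"
    then have "m [^] k \<otimes> m [^] (- k - 1) \<in> N" using that N_pow[OF m, of "- k - 1"] N_mult by auto
    then have "m [^] (k + (- k - 1)) \<in> N" using mc by (simp only: int_pow_mult)
    then show False using inv_m mc by (simp add: int_pow_neg)
  qed
  define D where "D v = {real_of_int p / real_of_int q | p q. 0 < q \<and> v [^] q \<otimes> m [^] (- p) \<in> N}" for v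
  define f where "f v = Sup (D v)" for v
  have DI: "p / q \<in> D v" if "0 < q" "v [^] q \<otimes> m [^] (- p) \<in> N" for v and p q :: int
    using that by (auto simp: D_def)
  have scale: "w [^] (k * n) \<otimes> m [^] (k * p) \<in> N"
    if "w \<in> carrier G" "0 \<le> k" "w [^] n \<otimes> m [^] p \<in> N" for w and k n p :: int
    using N_pow[OF that(3,2)] that mc by (simp add: int_pow_distrib int_pow_pow mult.commute)
  have ne: "D v \<noteq> {}" if v: "v \<in> carrier G" for v
  proof -
    obtain n where n: "n \<ge> 0" "m [^] (n::int) \<otimes> v \<in> N" using bnd[OF v] by auto
    then have "v [^] (1::int) \<otimes> m [^] (- (- n)) \<in> N" using mc v by (simp add: m_comm)
    from DI[OF _ this] show ?thesis by auto
  qed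
  \<comment> \<open>If \<open>v\<close> is below the power of \<open>m\<close> with exponent
    \<open>n\<close>, then \<open>p / q\<close> in \<open>D v\<close> places the power with exponent
    \<open>p\<close> below that with exponent \<open>n * q\<close>; \<open>neg\<close> turns this
    into an inequality of integers.\<close>
  have bdd: "bdd_above (D v)" if v: "v \<in> carrier G" for v
  proof -
    obtain n where n: "n \<ge> 0" "m [^] (n::int) \<otimes> inv v \<in> N" using bnd[OF v] by auto
    have "p / q \<le> n" if "0 < q" "v [^] q \<otimes> m [^] (- p) \<in> N" for p q :: int
    proof -
      have "(m [^] n \<otimes> inv v) [^] q \<otimes> (v [^] q \<otimes> m [^] (- p)) \<in> N"
        using that N_mult N_pow[OF n(2), of q] by auto
      also have "(m [^] n \<otimes> inv v) [^] q = m [^] (n * q) \<otimes> inv (v [^] q)"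
        using mc v by (simp add: int_pow_distrib int_pow_pow int_pow_inv)
      also have "m [^] (n * q) \<otimes> inv (v [^] q) \<otimes> (v [^] q \<otimes> m [^] (- p)) = m [^] (n * q) \<otimes> m [^] (- p)"
        using mc v by (metis int_pow_closed inv_closed inv_solve_left m_assoc m_closed)
      also have "\<dots> = m [^] (n * q - p)" using mc by (simp add: int_pow_mult[symmetric])
      finally have "p \<le> n * q" using neg by force
      then have "real_of_int p \<le> n * q" by (metis of_int_le_iff of_int_mult)
      then show ?thesis using that by (simp add: divide_le_eq)
    qed
    then show ?thesis unfolding D_def by (intro bdd_aboveI[of _ "real_of_int n"]) auto
  qed
  have super: "f v + f w \<le> f (v \<otimes> w)" if v: "v \<in> carrier G" and w: "w \<in> carrier G" for v w
  proof -
    have *: "x + y \<le> f (v \<otimes> w)" if x: "x \<in> D v" and y: "y \<in> D w" for x y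
    proof -
      obtain p q where pq: "x = real_of_int p / real_of_int q" "0 < q" "v [^] q \<otimes> m [^] (- p) \<in> N"
        using x by (auto simp: D_def)
      obtain r s where rs: "y = real_of_int r / real_of_int s" "0 < s" "w [^] s \<otimes> m [^] (- r) \<in> N"
        using y by (auto simp: D_def)
      \<comment> \<open>Both fractions are brought to the common denominator \<open>s * q\<close>
        before the two witnesses are multiplied.\<close>
      have "(v [^] (s * q) \<otimes> m [^] (s * - p)) \<otimes> (w [^] (q * s) \<otimes> m [^] (q * - r)) \<in> N"
        using scale[OF v _ pq(3), of s] scale[OF w _ rs(3), of q] pq rs N_mult by auto
      also have "(v [^] (s * q) \<otimes> m [^] (s * - p)) \<otimes> (w [^] (q * s) \<otimes> m [^] (q * - r)) =
          (v [^] (s * q) \<otimes> w [^] (s * q)) \<otimes> (m [^] (s * - p) \<otimes> m [^] (q * - r))"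
        using v w mc by (simp add: m_ac mult.commute)
      also have "\<dots> = (v \<otimes> w) [^] (s * q) \<otimes> m [^] (- (s * p + q * r))"
        using v w mc by (simp add: int_pow_distrib int_pow_mult[symmetric])
      finally have "(s * p + q * r) / (s * q) \<in> D (v \<otimes> w)"
        using pq rs DI[of "s * q" "v \<otimes> w" "s * p + q * r"] by simp
      then have "(s * p + q * r) / (s * q) \<le> f (v \<otimes> w)"
        unfolding f_def using bdd v w by (intro cSup_upper) auto
      moreover have "x + y = (s * p + q * r) / (s * q)" using pq rs by (simp add: field_simps)
      ultimately show ?thesis by simp
    qed
    have "f v \<le> f (v \<otimes> w) - y" if "y \<in> D w" for y
      unfolding f_def[of v] using *[OF _ that] ne[OF v] by (intro cSup_least) (auto simp: algebra_simps)
    then have "f w \<le> f (v \<otimes> w) - f v"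
      unfolding f_def[of w] using ne[OF w] by (intro cSup_least) (auto simp: algebra_simps)
    then show ?thesis by simp
  qed
  have one: "f \<one> \<le> 0"
    unfolding f_def
  proof (rule cSup_least[OF ne])
    fix x assume "x \<in> D \<one>"
    then obtain p q where pq: "x = real_of_int p / real_of_int q" "0 < q" "m [^] (- p) \<in> N"
      using mc by (auto simp: D_def)
    then have "p \<le> 0" using neg by force
    then show "x \<le> 0" using pq by (simp add: divide_nonpos_pos)
  qed simp
  have inv: "f (inv v) \<ge> - f v" if v: "v \<in> carrier G" for v
  proof (rule ccontr)
    assume "\<not> f (inv v) \<ge> - f v"
    then have "f v < - f (inv v)" by simp
    \<comment> \<open>A rational number above \<open>f v\<close> is not in \<open>D v\<close>, so
      totality puts the inverse of the witness into \<open>N\<close>. That makes \<open>- r\<close>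
      an element of \<open>D (inv v)\<close>, contradicting the choice of \<open>r\<close> below
      \<open>- f (inv v)\<close>.\<close>
    then obtain r where r: "r \<in> \<rat>" "f v < r" "r < - f (inv v)" using Rats_dense_in_real by blast
    then obtain p q :: int where pq: "0 < q" "r = real_of_int p / real_of_int q"
      using Rats_cases' by metis
    have "v [^] q \<otimes> m [^] (- p) \<notin> N"
    proof
      assume "v [^] q \<otimes> m [^] (- p) \<in> N"
      then have "r \<le> f v" unfolding f_def pq by (intro cSup_upper DI bdd pq v)
      then show False using r by simp
    qed
    then have "inv (v [^] q \<otimes> m [^] (- p)) \<in> N"
      using N_total[of "v [^] q \<otimes> m [^] (- p)"] v mc by auto
    then have "(inv v) [^] q \<otimes> m [^] (- (- p)) \<in> N"
      using v mc by (simp add: inv_mult int_pow_inv int_pow_neg)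
    then have "real_of_int (- p) / q \<le> f (inv v)" unfolding f_def by (intro cSup_upper DI bdd pq inv_closed v)
    then show False using r pq by simp
  qed
  have "f (v \<otimes> w) = f v + f w" if v: "v \<in> carrier G" and w: "w \<in> carrier G" for v w
  proof -
    \<comment> \<open>Superadditivity for the pair \<open>v \<otimes> w\<close>,
      \<open>inv w\<close>, with the bound on \<open>f (inv w)\<close>, gives the reverse
      inequality.\<close>
    have "f (v \<otimes> w) + f (inv w) \<le> f (v \<otimes> w \<otimes> inv w)" using v w by (intro super) auto
    also have "v \<otimes> w \<otimes> inv w = v" using v w by (simp add: m_assoc)
    finally show ?thesis using inv[OF w] super[OF v w] by simp
  qed
  then have "f \<in> hom G real_group" by (auto simp: hom_def real_group_def)
  moreover have "0 \<le> f u" if u: "u \<in> N" for u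
  proof -
    have "u [^] (1::int) \<otimes> m [^] (- 0 :: int) \<in> N" using u N_closed by auto
    from DI[OF _ this] have "0 \<in> D u" by simp
    then show ?thesis unfolding f_def using bdd u N_closed by (intro cSup_upper) auto
  qed
  moreover have "1 \<le> f m"
  proof -
    have "m [^] (1::int) \<otimes> m [^] (- 1 :: int) \<in> N" using N_one mc by (simp add: int_pow_neg)
    from DI[OF _ this] have "1 \<in> D m" by simp
    then show ?thesis unfolding f_def using bdd mc by (intro cSup_upper) auto
  qed
  ultimately show ?thesis using mc by (intro exI[of _ f]) force
qed

end

section \<open>Determined relations are preorders\<close>

locale comm_group_action = comm_group G + group_action G S \<phi>
  for G (structure) and S and \<phi>
begin

lemma act_closed: "u \<in> carrier G \<Longrightarrow> s \<in> S \<Longrightarrow> \<phi> u s \<in> S"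
  using element_image by blast

lemma act_one: "s \<in> S \<Longrightarrow> \<phi> \<one> s = s"
  using id_eq_one by (metis restrict_apply')

lemma act_inv: "u \<in> carrier G \<Longrightarrow> s \<in> S \<Longrightarrow> \<phi> (inv u) (\<phi> u s) = s"
  by (rule orbit_sym_aux) auto

end

locale stable_subset = comm_group_action +
  fixes P X
  assumes P: "subgroup P G" and X: "X \<subseteq> S" and X_stable: "stable \<phi> P X"
begin

lemma P_carrier: "u \<in> P \<Longrightarrow> u \<in> carrier G"
  using subgroup.subset[OF P] by auto

lemma X_S: "s \<in> X \<Longrightarrow> s \<in> S"
  using X by auto

lemmas P_closed = subgroup.m_closed[OF P] subgroup.m_inv_closed[OF P] subgroup.one_closed[OF P]

lemma act_X: "u \<in> P \<Longrightarrow> s \<in> X \<Longrightarrow> \<phi> u s \<in> X"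
  using X_stable by (auto simp: stable_def)

lemma act_mult: "u \<in> P \<Longrightarrow> v \<in> P \<Longrightarrow> s \<in> X \<Longrightarrow> \<phi> (u \<otimes> v) s = \<phi> u (\<phi> v s)"
  using composition_rule P_carrier X_S by auto

end

locale preordered_action = stable_subset G S \<phi> P X
  for G (structure) and S \<phi> P X +
  fixes R
  assumes R: "action_preorder (G\<lparr>carrier := P\<rparr>) X \<phi> R"
begin

lemma R_sub: "R \<subseteq> X \<times> X"
  using R by (auto simp: action_preorder_def preorder_on_def)

lemma R_refl: "s \<in> X \<Longrightarrow> (s, s) \<in> R"
  using R by (auto simp: action_preorder_def preorder_on_def refl_on_def)

lemma R_trans: "(r, s) \<in> R \<Longrightarrow> (s, t) \<in> R \<Longrightarrow> (r, t) \<in> R"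
  using R by (auto simp: action_preorder_def preorder_on_def dest: transD)

lemma R_total: "s \<in> X \<Longrightarrow> t \<in> X \<Longrightarrow> (s, t) \<in> R \<or> (t, s) \<in> R"
  using R R_refl by (cases "s = t") (auto simp: action_preorder_def total_on_def)

lemma R_act: "u \<in> P \<Longrightarrow> (s, t) \<in> R \<Longrightarrow> (\<phi> u s, \<phi> u t) \<in> R"
  using R R_sub by (auto simp: action_preorder_def)

lemma R_act_inv: "u \<in> P \<Longrightarrow> s \<in> X \<Longrightarrow> (\<phi> u s, t) \<in> R \<Longrightarrow> (s, \<phi> (inv u) t) \<in> R"
  using R_act[of "inv u" "\<phi> u s" t] P_closed act_inv P_carrier X_S by auto

end

text \<open>The pair \<open>f\<close>, \<open>g\<close> at one vertex, detached from any tree. It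
  serves both to analyse given numerical data and to construct new data.\<close>

locale graded_action = stable_subset G S \<phi> P X
  for G (structure) and S \<phi> P X +
  fixes f g K
  assumes f_mult: "\<And>u v. u \<in> P \<Longrightarrow> v \<in> P \<Longrightarrow> f (u \<otimes> v) = f u + (f v :: real)"
    and g_act: "\<And>u s. u \<in> P \<Longrightarrow> s \<in> X \<Longrightarrow> g (\<phi> u s) = f u + g s"
    and K: "K = {u \<in> P. f u = 0}"
begin

lemma f_one: "f \<one> = 0"
  using f_mult[of \<one> \<one>] P_closed by auto

lemma f_inv: "u \<in> P \<Longrightarrow> f (inv u) = - f u"
  using f_mult[of u "inv u"] P_closed P_carrier f_one by auto

lemma K_subgroup: "subgroup K G"
  using P_closed P_carrier f_mult f_inv f_one by unfold_locales (auto simp: K)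

text \<open>By equivariance \<open>f u = f v\<close>, so \<open>v \<otimes> inv u\<close> lies in
  the kernel.\<close>

lemma same_value_imp_K:
  assumes "u \<in> P" "v \<in> P" "s \<in> X" "g (\<phi> u s) = g (\<phi> v s)"
  shows "\<exists>w\<in>K. \<phi> v s = \<phi> w (\<phi> u s) \<and> v = w \<otimes> u"
proof -
  have "v = (v \<otimes> inv u) \<otimes> u" using assms P_carrier by (simp add: m_assoc)
  moreover have "v \<otimes> inv u \<in> K"
    using assms P_closed g_act[of u s] g_act[of v s] by (auto simp: K f_mult f_inv)
  ultimately show ?thesis
    using assms P_closed by (metis (no_types, lifting) K act_mult mem_Collect_eq)
qed

end

section \<open>Lexicographic relations, the recursion step of \<open>determined_rel\<close>\<close>

definition lex_rel ::
    "'g set \<Rightarrow> 's set \<Rightarrow> ('g \<Rightarrow> 's \<Rightarrow> 's) \<Rightarrow> ('s \<Rightarrow> real) \<Rightarrow> 'i set \<Rightarrow> ('i \<Rightarrow> 's set) \<Rightarrow> ('i \<Rightarrow> 's rel) \<Rightarrow> 's rel"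
  where "lex_rel P X \<phi> g I Y R = {(s, t). s \<in> X \<and> t \<in> X \<and> (g s < g t \<or> g s = g t \<and>
    (\<exists>u\<in>P. \<exists>i\<in>I. \<phi> u s \<in> Y i \<and> (\<phi> u s, \<phi> u t) \<in> R i))}"

text \<open>The properties of the children of a vertex on which the order arguments rest: each piece
  lies in a fibre of \<open>g\<close>, different pieces have values in different cosets of the image
  of \<open>f\<close>, and every point has a translate in some piece.\<close>

locale graded_pieces = graded_action G S \<phi> P X f g K
  for G (structure) and S \<phi> P X f g K +
  fixes I :: "'i set" and Y
  assumes Y: "\<And>i. i \<in> I \<Longrightarrow> Y i \<subseteq> X" and Y_stable: "\<And>i. i \<in> I \<Longrightarrow> stable \<phi> K (Y i)"
    and g_const: "\<And>i s t. i \<in> I \<Longrightarrow> s \<in> Y i \<Longrightarrow> t \<in> Y i \<Longrightarrow> g s = g t"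
    and coset_distinct: "\<And>i j s t. i \<in> I \<Longrightarrow> j \<in> I \<Longrightarrow> s \<in> Y i \<Longrightarrow> t \<in> Y j \<Longrightarrow>
        g s - g t \<in> f ` P \<Longrightarrow> i = j"
    and cover: "\<And>s. s \<in> X \<Longrightarrow> \<exists>u\<in>P. \<exists>i\<in>I. \<phi> u s \<in> Y i"
begin

text \<open>For equal values of \<open>g\<close>, the values at the two translates differ by an
  element of the image of \<open>f\<close>, so the pieces agree. As \<open>g\<close> is constant on
  a piece, \<open>f u = f v\<close>, and \<open>u\<close>, \<open>v\<close> differ by an element of
  the kernel, under which the piece is stable.\<close>

lemma same_piece:
  assumes "i \<in> I" "j \<in> I" "u \<in> P" "v \<in> P" "s \<in> X" "t \<in> X" "g s = g t"
    and "\<phi> u s \<in> Y i" "\<phi> v t \<in> Y j"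
  shows "i = j" and "\<phi> u t \<in> Y i" and "\<exists>w\<in>K. v = w \<otimes> u"
proof -
  have "g (\<phi> u s) - g (\<phi> v t) = f (u \<otimes> inv v)"
    using assms P_closed by (simp add: g_act f_mult f_inv)
  moreover have "u \<otimes> inv v \<in> P" using assms P_closed by blast
  ultimately have "g (\<phi> u s) - g (\<phi> v t) \<in> f ` P" by (rule image_eqI)
  then show ij: "i = j" by (rule coset_distinct[OF assms(1,2,8,9)])
  have "g (\<phi> v t) = g (\<phi> u s)" using assms(8,9) ij by (intro g_const[OF assms(1)]) auto
  also have "\<dots> = g (\<phi> u t)" using assms by (simp add: g_act)
  finally have vu: "g (\<phi> v t) = g (\<phi> u t)" .
  then obtain w where "w \<in> K" "\<phi> u t = \<phi> w (\<phi> v t)"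
    using same_value_imp_K[of v u t] assms by auto
  then show "\<phi> u t \<in> Y i" using Y_stable[of i] assms ij by (auto simp: stable_def)
  show "\<exists>w\<in>K. v = w \<otimes> u" using same_value_imp_K[of u v t] vu assms by auto
qed

text \<open>The choice of \<open>u\<close> in the recursion is immaterial: another choice leads to
  the same piece and differs from \<open>u\<close> by an element of \<open>K\<close>, under which
  the relation on the piece is invariant.\<close>

lemma lex_rel_iff:
  assumes R: "\<And>i. i \<in> I \<Longrightarrow> action_preorder (G\<lparr>carrier := K\<rparr>) (Y i) \<phi> (R i)"
    and "s \<in> X" "t \<in> X" "g s = g t" "u \<in> P" "i \<in> I" "\<phi> u s \<in> Y i"
  shows "(s, t) \<in> lex_rel P X \<phi> g I Y R \<longleftrightarrow> (\<phi> u s, \<phi> u t) \<in> R i"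
proof
  assume "(\<phi> u s, \<phi> u t) \<in> R i"
  then show "(s, t) \<in> lex_rel P X \<phi> g I Y R" using assms by (auto simp: lex_rel_def)
next
  assume "(s, t) \<in> lex_rel P X \<phi> g I Y R"
  then obtain v j where v: "v \<in> P" "j \<in> I" "\<phi> v s \<in> Y j" "(\<phi> v s, \<phi> v t) \<in> R j"
    using assms(4) by (auto simp: lex_rel_def)
  have ji: "j = i" using same_piece(1)[of j i v u s s] v assms by auto
  obtain w where w: "w \<in> K" "u = w \<otimes> v" using same_piece(3)[of j i v u s s] v assms by auto
  have "\<phi> v t \<in> Y i"
    using R[OF v(2)] v(4) ji by (auto simp: action_preorder_def preorder_on_def)
  then have "(\<phi> w (\<phi> v s), \<phi> w (\<phi> v t)) \<in> R i"
    using R[OF assms(6)] v w ji by (auto simp: action_preorder_def)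
  then show "(\<phi> u s, \<phi> u t) \<in> R i" using w v assms act_mult by (auto simp: K)
qed

text \<open>Different values of \<open>g\<close> decide at once. Points with the same value are
  brought into a common piece by a single \<open>u\<close>, so each property reduces to that of the
  relation on the piece.\<close>

lemma lex_rel_preorder:
  assumes R: "\<And>i. i \<in> I \<Longrightarrow> action_preorder (G\<lparr>carrier := K\<rparr>) (Y i) \<phi> (R i)"
  shows "action_preorder (G\<lparr>carrier := P\<rparr>) X \<phi> (lex_rel P X \<phi> g I Y R)"
proof -
  let ?L = "lex_rel P X \<phi> g I Y R"
  note iff = lex_rel_iff[OF R]
  have R_refl: "(s, s) \<in> R i" if "i \<in> I" "s \<in> Y i" for i s
    using R[OF that(1)] that by (auto simp: action_preorder_def preorder_on_def refl_on_def)
  have R_total: "(s, t) \<in> R i \<or> (t, s) \<in> R i" if "i \<in> I" "s \<in> Y i" "t \<in> Y i" for i s t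
    using R[OF that(1)] R_refl[OF that(1,2)] that
    by (cases "s = t") (auto simp: action_preorder_def total_on_def)
  have R_trans: "(r, t) \<in> R i" if "i \<in> I" "(r, s) \<in> R i" "(s, t) \<in> R i" for i r s t
    using R[OF that(1)] that by (auto simp: action_preorder_def preorder_on_def dest: transD)
  have sub: "?L \<subseteq> X \<times> X" by (auto simp: lex_rel_def)
  have le: "g s \<le> g t" if "(s, t) \<in> ?L" for s t using that by (auto simp: lex_rel_def)
  have less: "(s, t) \<in> ?L" if "s \<in> X" "t \<in> X" "g s < g t" for s t
    using that by (auto simp: lex_rel_def)
  have refl: "(s, s) \<in> ?L" if s: "s \<in> X" for s
  proof -
    obtain u i where "u \<in> P" "i \<in> I" "\<phi> u s \<in> Y i" using cover[OF s] by auto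
    then show ?thesis using iff[of s s u i] s R_refl by auto
  qed
  have total: "(s, t) \<in> ?L \<or> (t, s) \<in> ?L" if st: "s \<in> X" "t \<in> X" for s t
  proof (cases "g s = g t")
    case True
    obtain u i where u: "u \<in> P" "i \<in> I" "\<phi> u s \<in> Y i" using cover[OF st(1)] by auto
    obtain v j where v: "v \<in> P" "j \<in> I" "\<phi> v t \<in> Y j" using cover[OF st(2)] by auto
    have "\<phi> u t \<in> Y i" using same_piece(2)[of i j u v s t] u v st True by auto
    then show ?thesis using iff[of s t u i] iff[of t s u i] R_total u st True by auto
  next
    case False
    then show ?thesis using less st by (cases "g s < g t") auto
  qed
  have trans: "(r, t) \<in> ?L" if "(r, s) \<in> ?L" "(s, t) \<in> ?L" for r s t
  proof -
    have X: "r \<in> X" "s \<in> X" "t \<in> X" using that sub by auto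
    show ?thesis
    proof (cases "g r = g s \<and> g s = g t")
      case True
      obtain u i where u: "u \<in> P" "i \<in> I" "\<phi> u r \<in> Y i" using cover[OF X(1)] by auto
      have rs: "(\<phi> u r, \<phi> u s) \<in> R i" using iff[of r s u i] u X True that by auto
      then have "\<phi> u s \<in> Y i"
        using R[OF u(2)] by (auto simp: action_preorder_def preorder_on_def)
      then have "(\<phi> u s, \<phi> u t) \<in> R i" using iff[of s t u i] u X True that by auto
      then have "(\<phi> u r, \<phi> u t) \<in> R i" using R_trans[OF u(2) rs] by auto
      then show ?thesis using iff[of r t u i] u X True by auto
    next
      case False
      then have "g r < g t" using le[OF that(1)] le[OF that(2)] by linarith
      then show ?thesis using less X by auto
    qed
  qed
  have act: "(\<phi> u s, \<phi> u t) \<in> ?L" if "u \<in> P" "s \<in> X" "t \<in> X" "(s, t) \<in> ?L" for u s t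
  proof (cases "g s = g t")
    case True
    have us: "\<phi> u s \<in> X" "\<phi> u t \<in> X" using that act_X by auto
    obtain v i where v: "v \<in> P" "i \<in> I" "\<phi> v (\<phi> u s) \<in> Y i" using cover[OF us(1)] by auto
    then have "(\<phi> v (\<phi> u s), \<phi> v (\<phi> u t)) \<in> R i"
      using iff[of s t "v \<otimes> u" i] that True P_closed act_mult by auto
    then show ?thesis using iff[of "\<phi> u s" "\<phi> u t" v i] us v True that g_act by auto
  next
    case False
    then have "g s < g t" using le[OF that(4)] by linarith
    then show ?thesis using less that act_X g_act by auto
  qed
  show ?thesis
    using sub refl total trans act
    unfolding action_preorder_def preorder_on_def refl_on_def total_on_def trans_def by auto
qed

end

section \<open>Preotrees and numerical data by recursion on the tree\<close>

lemma ball_vertices: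
  "(\<forall>p\<in>vertices (Vertex P X ts). Q p (subtree (Vertex P X ts) p)) \<longleftrightarrow>
     Q [] (Vertex P X ts) \<and> (\<forall>i<length ts. \<forall>p\<in>vertices (ts ! i). Q (i # p) (subtree (ts ! i) p))"
  by auto

lemma determined_rel_Vertex:
  "determined_rel \<phi> (Vertex P X ts) g =
    (if ts = [] then X \<times> X
     else lex_rel P X \<phi> (g []) {..<length ts} (\<lambda>i. pts (ts ! i))
            (\<lambda>i. determined_rel \<phi> (ts ! i) (\<lambda>p. g (i # p))))"
  by (simp add: lex_rel_def)

declare determined_rel.simps [simp del] vertices.simps [simp del]

lemma numerical_data_Vertex:
  "numerical_data G \<phi> (Vertex P X ts) f g \<longleftrightarrow>
    (ts \<noteq> [] \<longrightarrow> vertex_data G \<phi> (Vertex P X ts) (f []) (g [])) \<and>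
    (\<forall>i<length ts. numerical_data G \<phi> (ts ! i) (\<lambda>p. f (i # p)) (\<lambda>p. g (i # p)))"
  unfolding numerical_data_def
    ball_vertices[where Q = "\<lambda>p x. children x \<noteq> [] \<longrightarrow> vertex_data G \<phi> x (f p) (g p)"]
  by simp

context graded_action
begin

lemma real_coset_eq_iff:
  "f ` P #>\<^bsub>real_group\<^esub> a = f ` P #>\<^bsub>real_group\<^esub> b \<longleftrightarrow> a - b \<in> f ` P"
proof -
  have coset: "f ` P #>\<^bsub>real_group\<^esub> x = {f u + x | u. u \<in> P}" for x
    by (auto simp: r_coset_def real_group_def)
  show ?thesis
  proof
    assume eq: "f ` P #>\<^bsub>real_group\<^esub> a = f ` P #>\<^bsub>real_group\<^esub> b"
    have "a \<in> {f u + a | u. u \<in> P}" using f_one P_closed by force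
    then obtain u where "u \<in> P" "a = f u + b" using eq unfolding coset by auto
    then show "a - b \<in> f ` P" by auto
  next
    assume "a - b \<in> f ` P"
    then obtain w where w: "w \<in> P" "a = f w + b" by auto
    show "f ` P #>\<^bsub>real_group\<^esub> a = f ` P #>\<^bsub>real_group\<^esub> b"
      unfolding coset
    proof (intro equalityI subsetI)
      fix x assume "x \<in> {f u + a | u. u \<in> P}"
      then obtain u where "u \<in> P" "x = f (u \<otimes> w) + b" using w f_mult by auto
      then show "x \<in> {f u + b | u. u \<in> P}" using w P_closed by auto
    next
      fix x assume "x \<in> {f u + b | u. u \<in> P}"
      then obtain u where "u \<in> P" "x = f (u \<otimes> inv w) + a" using w f_mult f_inv P_closed by auto
      then show "x \<in> {f u + a | u. u \<in> P}" using w P_closed by auto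
    qed
  qed
qed

lemma orbit_P: "orbit (G\<lparr>carrier := P\<rparr>) \<phi> s = {\<phi> u s | u. u \<in> P}"
  by (simp add: orbit_def)

end

context comm_group_action
begin

definition vertex_ok :: "('a, 'c) ltree \<Rightarrow> bool"
  where "vertex_ok x \<longleftrightarrow>
    saturated G (grp x) \<and> pts x \<subseteq> S \<and> stable \<phi> (grp x) (pts x) \<and> children_ok G \<phi> x"

text \<open>This is \<open>preotree\<close> without the root labels. Saturation of each vertex label
  is still measured in the fixed group \<open>G\<close>, so the property passes to subtrees
  unchanged.\<close>

definition tree_ok :: "('a, 'c) ltree \<Rightarrow> bool"
  where "tree_ok \<tau> \<longleftrightarrow> (\<forall>p\<in>vertices \<tau>. vertex_ok (subtree \<tau> p))"

lemma preotree_iff: "preotree G S \<phi> \<tau> \<longleftrightarrow> grp \<tau> = carrier G \<and> pts \<tau> = S \<and> tree_ok \<tau>"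
  by (simp add: preotree_def tree_ok_def vertex_ok_def Let_def)

lemma tree_ok_Vertex:
  "tree_ok (Vertex P X ts) \<longleftrightarrow> vertex_ok (Vertex P X ts) \<and> (\<forall>y\<in>set ts. tree_ok y)"
  unfolding tree_ok_def ball_vertices[where Q = "\<lambda>_. vertex_ok"] by (metis in_set_conv_nth)

lemma vertex_graded_pieces:
  assumes tree: "tree_ok (Vertex P X ts)" and data: "vertex_data G \<phi> (Vertex P X ts) f g"
    and ts: "ts \<noteq> []"
  defines "K \<equiv> {u \<in> P. f u = 0}"
  shows "graded_pieces G S \<phi> P X f g K {..<length ts} (\<lambda>i. pts (ts ! i))"
    and "\<forall>y\<in>set ts. grp y = K"
proof -
  have P: "subgroup P G" and X: "X \<subseteq> S" and st: "stable \<phi> P X"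
    and ch: "children_ok G \<phi> (Vertex P X ts)"
    using tree by (auto simp: tree_ok_Vertex vertex_ok_def saturated_def)
  have f: "f \<in> hom (G\<lparr>carrier := P\<rparr>) real_group"
    and g: "\<forall>u\<in>P. \<forall>s\<in>X. g (\<phi> u s) = f u + g s"
    and y: "\<forall>y\<in>set ts. grp y = kernel (G\<lparr>carrier := P\<rparr>) real_group f \<and> (\<exists>c. \<forall>s\<in>pts y. g s = c)"
    and dist: "\<forall>i<length ts. \<forall>j<length ts. i \<noteq> j \<longrightarrow> (\<forall>s\<in>pts (ts ! i). \<forall>t\<in>pts (ts ! j).
            f ` P #>\<^bsub>real_group\<^esub> g s \<noteq> f ` P #>\<^bsub>real_group\<^esub> g t)"
    using data by (simp_all add: vertex_data_def Let_def)
  interpret graded_action G S \<phi> P X f g K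
    by (intro graded_action.intro graded_action_axioms.intro stable_subset.intro
        stable_subset_axioms.intro comm_group_action_axioms)
      (use P X st f g in \<open>auto simp: K_def hom_def real_group_def\<close>)
  show grp: "\<forall>y\<in>set ts. grp y = K"
    using y by (auto simp: kernel_def K_def real_group_def)
  have tsi: "ts ! i \<in> set ts" if "i < length ts" for i using that by simp
  show "graded_pieces G S \<phi> P X f g K {..<length ts} (\<lambda>i. pts (ts ! i))"
  proof
    fix i assume i: "i \<in> {..<length ts}"
    then show "pts (ts ! i) \<subseteq> X" using ch tsi[of i] by (simp add: children_ok_def)
    show "g s = g t" if "s \<in> pts (ts ! i)" "t \<in> pts (ts ! i)" for s t
      using y tsi[of i] i that by (metis lessThan_iff)
    fix j s t assume j: "j \<in> {..<length ts}" "s \<in> pts (ts ! i)" "t \<in> pts (ts ! j)" "g s - g t \<in> f ` P"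
    then show "i = j" using dist i real_coset_eq_iff[of "g s" "g t"] by auto
  next
    fix i assume i: "i \<in> {..<length ts}"
    then have "vertex_ok (ts ! i)"
      using tree by (cases "ts ! i") (auto simp: tree_ok_Vertex all_set_conv_all_nth)
    then show "stable \<phi> K (pts (ts ! i))" using grp tsi[of i] i by (auto simp: vertex_ok_def)
  next
    fix s assume s: "s \<in> X"
    let ?O = "orbit (G\<lparr>carrier := P\<rparr>) \<phi> s"
    have "?O \<in> orbits (G\<lparr>carrier := P\<rparr>) X \<phi>" using s by (auto simp: orbits_def)
    then have "(\<Union>z\<in>set ts. pts z) \<inter> ?O \<in> orbits (G\<lparr>carrier := grp (hd ts)\<rparr>) X \<phi>"
      using ch ts by (simp add: children_ok_def)
    then obtain x where x: "x \<in> X" "(\<Union>z\<in>set ts. pts z) \<inter> ?O = orbit (G\<lparr>carrier := K\<rparr>) \<phi> x"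
      using ts grp by (auto simp: orbits_def)
    \<comment> \<open>The orbit of \<open>s\<close> meets the union of the children in an orbit of
      \<open>K\<close>, which is nonempty as it contains its own base point \<open>x\<close>. Hence
      some translate of \<open>s\<close> lies in a child.\<close>
    have "x \<in> orbit (G\<lparr>carrier := K\<rparr>) \<phi> x"
      using act_one[OF X_S[OF x(1)]] P_closed f_one by (force simp: orbit_def K_def)
    then obtain z where "z \<in> set ts" "x \<in> pts z" "x \<in> ?O" using x by auto
    then show "\<exists>u\<in>P. \<exists>i\<in>{..<length ts}. \<phi> u s \<in> pts (ts ! i)"
      by (auto simp: orbit_P in_set_conv_nth)
  qed
qed

text \<open>The data stay arbitrary in the induction, since the child at index \<open>i\<close> uses
  them shifted by \<open>i\<close>.\<close>

theorem determined_rel_preorder: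
  assumes "tree_ok \<tau>" "numerical_data G \<phi> \<tau> f g"
  shows "action_preorder (G\<lparr>carrier := grp \<tau>\<rparr>) (pts \<tau>) \<phi> (determined_rel \<phi> \<tau> g)"
  using assms
proof (induction \<tau> arbitrary: f g)
  case (Vertex P X ts)
  show ?case
  proof (cases "ts = []")
    case True
    then show ?thesis
      using Vertex.prems(1)
      by (auto simp: determined_rel_Vertex tree_ok_Vertex vertex_ok_def stable_def
          action_preorder_def preorder_on_def refl_on_def trans_def total_on_def)
  next
    case False
    have data: "vertex_data G \<phi> (Vertex P X ts) (f []) (g [])"
      using Vertex.prems(2) False by (simp add: numerical_data_Vertex)
    define K where "K = {u \<in> P. f [] u = 0}"
    interpret graded_pieces G S \<phi> P X "f []" "g []" K "{..<length ts}" "\<lambda>i. pts (ts ! i)"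
      unfolding K_def by (rule vertex_graded_pieces[OF Vertex.prems(1) data False])
    have grp: "\<forall>y\<in>set ts. grp y = K"
      unfolding K_def by (rule vertex_graded_pieces[OF Vertex.prems(1) data False])
    have "action_preorder (G\<lparr>carrier := K\<rparr>) (pts (ts ! i)) \<phi>
            (determined_rel \<phi> (ts ! i) (\<lambda>p. g (i # p)))" if "i < length ts" for i
    proof -
      have "tree_ok (ts ! i)" "ts ! i \<in> set ts" using Vertex.prems(1) that by (auto simp: tree_ok_Vertex)
      moreover have "numerical_data G \<phi> (ts ! i) (\<lambda>p. f (i # p)) (\<lambda>p. g (i # p))"
        using Vertex.prems(2) that by (simp add: numerical_data_Vertex)
      ultimately show ?thesis using Vertex.IH grp by metis
    qed
    then show ?thesis
      using False lex_rel_preorder[of "\<lambda>i. determined_rel \<phi> (ts ! i) (\<lambda>p. g (i # p))"]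
      by (simp add: determined_rel_Vertex)
  qed
qed

end

section \<open>Every preorder is determined by a preotree\<close>

text \<open>A basis element and zero are distinct. This excludes a vanishing \<open>f\<close> when
  the quotient by its kernel has rank one.\<close>

lemma free_abelian_of_rank_one_nontrivial:
  fixes L :: "('a, 'm) monoid_scheme"
  assumes "free_abelian_of_rank L 1"
  shows "carrier L \<noteq> {a}"
proof
  assume L: "carrier L = {a}"
  obtain B :: "'a set" where "card B = 1" "L \<cong> free_Abelian_group B"
    using assms by (auto simp: free_abelian_of_rank_def)
  then obtain b h where b: "B = {b}" and h: "bij_betw h (carrier L) (carrier (free_Abelian_group {b}))"
    by (auto simp: is_iso_def iso_def card_1_singleton_iff)
  have "frag_of b \<in> carrier (free_Abelian_group {b})" "0 \<in> carrier (free_Abelian_group {b})"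
    by simp_all
  moreover have "carrier (free_Abelian_group {b}) = {h a}" using h L by (auto simp: bij_betw_def)
  ultimately have "frag_of b = h a" "0 = h a" by (simp_all only: singleton_iff)
  then show False using frag_of_nonzero by metis
qed

lemma (in comm_group) comm_group_restrict:
  assumes "subgroup H G"
  shows "comm_group (G\<lparr>carrier := H\<rparr>)"
proof -
  interpret H: group "G\<lparr>carrier := H\<rparr>" by (rule subgroup_imp_group[OF assms])
  show ?thesis
    by (rule H.group_comm_groupI) (use m_comm subgroup.subset[OF assms] in auto)
qed

lemma (in comm_group) pure_subgroup_restrict:
  assumes "pure_subgroup G K" "subgroup H G" "K \<subseteq> H"
  shows "pure_subgroup (G\<lparr>carrier := H\<rparr>) K"
  using assms subgroup_incl[of K H] int_pow_consistent[OF assms(2)] subgroup.subset[OF assms(2)]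
  by (auto simp: pure_subgroup_def)

section \<open>Kernels of real-valued homomorphisms and cyclic images\<close>

context graded_action
begin

lemma f_int_pow:
  assumes u: "u \<in> P"
  shows "f (u [^] (n::int)) = n * f u"
proof -
  have nat: "u [^] k \<in> P \<and> f (u [^] k) = k * f u" for k :: nat
    by (induction k) (use u P_closed f_one f_mult in \<open>auto simp: algebra_simps\<close>)
  show ?thesis
  proof (cases n)
    case (nonneg k)
    then show ?thesis using nat[of k] by (simp add: int_pow_int)
  next
    case (neg k)
    then have "u [^] n = inv (u [^] Suc k)" using u P_carrier int_pow_neg_int by blast
    then show ?thesis using nat[of "Suc k"] f_inv[of "u [^] Suc k"]
      by (metis neg of_int_minus of_int_of_nat_eq mult_minus_left)
  qed
qed

text \<open>The reals are torsion-free: if a nonzero power of \<open>u\<close> is in the kernel,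
  purity of \<open>P\<close> gives \<open>u\<close> in \<open>P\<close>, and then
  \<open>n * f u = 0\<close> forces \<open>f u = 0\<close>.\<close>

lemma pure_K: "pure_subgroup G P \<Longrightarrow> pure_subgroup G K"
  using K_subgroup f_int_pow by (auto simp: pure_subgroup_def K)

lemma K_eq_P_iff: "K = P \<longleftrightarrow> (\<forall>u\<in>P. f u = 0)"
  by (auto simp: K)

lemma f_hom: "f \<in> hom (G\<lparr>carrier := P\<rparr>) real_group"
  using f_mult by (auto simp: hom_def real_group_def)

lemma kernel_f: "kernel (G\<lparr>carrier := P\<rparr>) real_group f = K"
  by (auto simp: kernel_def K real_group_def)

text \<open>Translates the hypothesis of the condition on cyclic images from the quotient group to
  real numbers: \<open>f u\<^sub>0\<close> is nonzero, and its integer multiples exhaust the image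
  of \<open>f\<close>.\<close>

lemma generator_of_quotient:
  assumes rank: "free_abelian_of_rank (G\<lparr>carrier := P\<rparr> Mod K) 1" and u0: "u\<^sub>0 \<in> P"
    and gen: "generate (G\<lparr>carrier := P\<rparr> Mod K) {K #>\<^bsub>G\<lparr>carrier := P\<rparr>\<^esub> u\<^sub>0} =
      carrier (G\<lparr>carrier := P\<rparr> Mod K)"
  shows "f u\<^sub>0 \<noteq> 0" and "\<forall>u\<in>P. \<exists>k::int. f u = k * f u\<^sub>0"
proof -
  let ?P = "G\<lparr>carrier := P\<rparr>"
  interpret P: comm_group ?P by (rule comm_group_restrict[OF P])
  have KP: "subgroup K ?P" using subgroup_incl[OF K_subgroup P] by (auto simp: K)
  interpret N: normal K ?P using KP by (simp add: P.normal_iff_subgroup)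
  interpret Q: group "?P Mod K" by (rule N.factorgroup_is_group)
  interpret q: group_hom ?P "?P Mod K" "r_coset ?P K"
    by (simp add: group_hom_def group_hom_axioms_def P.group_axioms Q.group_axioms N.r_coset_hom_Mod)
  have cyc: "v \<in> P \<and> (\<exists>k::int. f v = k * f u\<^sub>0)" if "v \<in> generate ?P {u\<^sub>0}" for v
    using that
  proof (induction rule: generate.induct)
    case one
    then show ?case using f_one P_closed by (auto intro!: exI[of _ 0])
  next
    case (incl h)
    then show ?case using u0 by (auto intro!: exI[of _ 1])
  next
    case (inv h)
    then show ?case using u0 f_inv P_closed m_inv_consistent[OF P] by (auto intro!: exI[of _ "-1"])
  next
    case (eng h1 h2)
    then obtain k l :: int where "f h1 = k * f u\<^sub>0" "f h2 = l * f u\<^sub>0" by blast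
    then show ?case using eng P_closed f_mult by (auto intro!: exI[of _ "k + l"] simp: algebra_simps)
  qed
  show mult: "\<forall>u\<in>P. \<exists>k::int. f u = k * f u\<^sub>0"
  proof
    fix u assume u: "u \<in> P"
    \<comment> \<open>The quotient map carries the cyclic group generated by
      \<open>u\<^sub>0\<close> onto the whole quotient, so \<open>u\<close> agrees modulo
      \<open>K\<close> with some element of that group.\<close>
    have "generate (?P Mod K) {K #>\<^bsub>?P\<^esub> u\<^sub>0} = r_coset ?P K ` generate ?P {u\<^sub>0}"
      using q.generate_img[of "{u\<^sub>0}"] u0 by simp
    moreover have "K #>\<^bsub>?P\<^esub> u \<in> carrier (?P Mod K)" using u by (auto simp: carrier_FactGroup)
    ultimately have "K #>\<^bsub>?P\<^esub> u \<in> r_coset ?P K ` generate ?P {u\<^sub>0}" using gen by argo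
    then obtain v where v: "v \<in> generate ?P {u\<^sub>0}" "K #>\<^bsub>?P\<^esub> u = K #>\<^bsub>?P\<^esub> v" by (rule imageE)
    have "u \<in> K #>\<^bsub>?P\<^esub> v" using P.rcos_self[OF _ KP, of u] u v by auto
    then obtain w where "w \<in> K" "u = w \<otimes> v" by (auto simp: r_coset_def)
    then show "\<exists>k::int. f u = k * f u\<^sub>0" using cyc[OF v(1)] f_mult by (auto simp: K)
  qed
  show "f u\<^sub>0 \<noteq> 0"
  proof
    assume "f u\<^sub>0 = 0"
    then have "K = P" using mult by (auto simp: K_eq_P_iff)
    then have "carrier (?P Mod K) = {P}"
      using P.coset_join2[OF _ KP] P_closed by (auto simp: carrier_FactGroup)
    then show False using free_abelian_of_rank_one_nontrivial[OF rank] by blast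
  qed
qed

end

text \<open>\<open>M\<close> plays the role of the image of \<open>f\<close>, and \<open>V\<close>
  that of the values of \<open>g\<close>. If \<open>M\<close> is infinite cyclic with positive
  generator \<open>a\<close>, the values are reduced modulo \<open>a\<close> and shifted by
  \<open>\<delta>\<close> into the open interval from 0 to \<open>a\<close>. Otherwise the last
  condition is vacuous, and representatives are taken from \<open>V\<close> itself.\<close>

lemma real_transversal:
  fixes M V :: "real set"
  assumes V: "finite V" and M: "0 \<in> M" "\<forall>x\<in>M. \<forall>y\<in>M. x - y \<in> M"
  shows "\<exists>\<delta> C. finite C \<and> (\<forall>c\<in>C. \<forall>d\<in>C. c - d \<in> M \<longrightarrow> c = d) \<and>
    (\<forall>v\<in>V. \<exists>c\<in>C. c - (v + \<delta>) \<in> M) \<and>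
    (\<forall>m\<in>M. m \<noteq> 0 \<longrightarrow> (\<forall>x\<in>M. \<exists>k::int. x = k * m) \<longrightarrow> (\<forall>c\<in>C. 0 < c \<and> c < \<bar>m\<bar>))"
proof (cases "\<exists>m\<in>M. m \<noteq> 0 \<and> (\<forall>x\<in>M. \<exists>k::int. x = k * m)")
  case True
  then obtain m0 where m0: "m0 \<in> M" "m0 \<noteq> 0" "\<forall>x\<in>M. \<exists>k::int. x = k * m0" by auto
  define a where "a = \<bar>m0\<bar>"
  have a: "0 < a" using m0 by (simp add: a_def)
  have neg: "- x \<in> M" if "x \<in> M" for x using M(2)[rule_format, OF M(1) that] by simp
  have add: "x + y \<in> M" if "x \<in> M" "y \<in> M" for x y using M(2)[rule_format, OF that(1) neg[OF that(2)]] by simp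
  have aM: "a \<in> M" using m0 neg by (auto simp: a_def abs_if)
  have nat: "real n * a \<in> M" for n
    by (induction n) (use M aM add in \<open>auto simp: algebra_simps\<close>)
  have int: "real_of_int k * a \<in> M" for k
  proof (cases k)
    case (nonneg n)
    then show ?thesis using nat by simp
  next
    case (neg n)
    then show ?thesis using \<open>\<And>x. x \<in> M \<Longrightarrow> - x \<in> M\<close>[OF nat[of "Suc n"]]
      by (metis of_int_minus of_int_of_nat_eq mult_minus_left)
  qed
  have Ma: "\<exists>k::int. x = k * a" if x: "x \<in> M" for x
  proof -
    obtain k :: int where k: "x = k * m0" using m0 x by auto
    show ?thesis
      by (rule exI[of _ "if m0 > 0 then k else - k"]) (auto simp: k a_def)
  qed
  have small: "x = 0" if x: "x \<in> M" "\<bar>x\<bar> < a" for x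
  proof -
    obtain k :: int where k: "x = k * a" using Ma x(1) by auto
    then have "\<bar>real_of_int k\<bar> < 1" using x a by (simp add: abs_mult)
    then have "k = 0" by linarith
    then show ?thesis using k by simp
  qed
  define r where "r v = v - a * \<lfloor>v / a\<rfloor>" for v :: real
  have r: "0 \<le> r v" "r v < a" for v
  proof -
    have "of_int \<lfloor>v / a\<rfloor> \<le> v / a" "v / a < of_int \<lfloor>v / a\<rfloor> + 1" by linarith+
    then have "of_int \<lfloor>v / a\<rfloor> * a \<le> v" "v < (of_int \<lfloor>v / a\<rfloor> + 1) * a"
      using a by (simp_all only: pos_le_divide_eq pos_divide_less_eq)
    then show "0 \<le> r v" "r v < a" by (simp_all add: r_def algebra_simps)
  qed
  \<comment> \<open>The largest residue, with 0 inserted to cover empty \<open>V\<close>. Shifting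
    by half of the gap between \<open>b\<close> and \<open>a\<close> makes all residues positive and
    keeps them below \<open>a\<close>.\<close>
  define b where "b = Max (insert 0 (r ` V))"
  have b: "b < a" "\<forall>v\<in>V. r v \<le> b" using r a V by (auto simp: b_def)
  define \<delta> where "\<delta> = (a - b) / 2"
  define C where "C = (\<lambda>v. r v + \<delta>) ` V"
  have C: "0 < c" "c < a" if "c \<in> C" for c
    using that r b by (auto simp: C_def \<delta>_def field_simps add_nonneg_pos) (smt (verit) b)
  have "\<forall>v\<in>V. \<exists>c\<in>C. c - (v + \<delta>) \<in> M"
  proof
    fix v assume "v \<in> V"
    moreover have "r v + \<delta> - (v + \<delta>) = real_of_int (- \<lfloor>v / a\<rfloor>) * a" by (simp add: r_def)
    then have "r v + \<delta> - (v + \<delta>) \<in> M" by (metis int)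
    ultimately show "\<exists>c\<in>C. c - (v + \<delta>) \<in> M" by (auto simp: C_def)
  qed
  moreover have "\<forall>c\<in>C. \<forall>d\<in>C. c - d \<in> M \<longrightarrow> c = d"
  proof (intro ballI impI)
    fix c d assume "c \<in> C" "d \<in> C" "c - d \<in> M"
    then show "c = d" using small[of "c - d"] C[of c] C[of d] by auto
  qed
  \<comment> \<open>Two generators of a cyclic group are integer multiples of each other, hence
    equal up to sign.\<close>
  moreover have "\<bar>m\<bar> = a" if m: "m \<in> M" "m \<noteq> 0" "\<forall>x\<in>M. \<exists>k::int. x = k * m" for m
  proof -
    obtain k :: int where k: "m = k * a" using Ma m(1) by auto
    obtain l :: int where l: "a = l * m" using m(3) aM by auto
    have "k \<noteq> 0" "l \<noteq> 0" using k l m a by auto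
    then have "1 \<le> \<bar>real_of_int k\<bar>" "1 \<le> \<bar>real_of_int l\<bar>" by linarith+
    then have "1 * a \<le> \<bar>real_of_int k\<bar> * a" "1 * \<bar>m\<bar> \<le> \<bar>real_of_int l\<bar> * \<bar>m\<bar>"
      using a by (intro mult_right_mono; simp)+
    moreover have "\<bar>m\<bar> = \<bar>real_of_int k\<bar> * a" using k a by (simp add: abs_mult)
    moreover have "a = \<bar>real_of_int l\<bar> * \<bar>m\<bar>" using l a by (metis abs_mult abs_of_pos)
    ultimately show ?thesis by linarith
  qed
  ultimately show ?thesis using C V by (intro exI[of _ \<delta>] exI[of _ C]) (auto simp: C_def)
next
  case False
  \<comment> \<open>One representative from \<open>V\<close> for each coset: the predicate depends
    on \<open>v\<close> only modulo \<open>M\<close>, so equal cosets receive the same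
    choice.\<close>
  define h where "h v = (SOME w. w \<in> V \<and> w - v \<in> M)" for v
  have h: "h v \<in> V \<and> h v - v \<in> M" if "v \<in> V" for v
    unfolding h_def by (rule someI[of _ v]) (use that M in auto)
  have neg: "- x \<in> M" if "x \<in> M" for x using M(2)[rule_format, OF M(1) that] by simp
  have h_eq: "h v = h w" if "v - w \<in> M" for v w
  proof -
    have "x - v \<in> M \<longleftrightarrow> x - w \<in> M" for x
      using M(2)[rule_format, OF _ neg[OF that], of "x - v"] M(2)[rule_format, OF _ that, of "x - w"] by auto
    then show ?thesis by (simp add: h_def)
  qed
  have "\<forall>c\<in>h ` V. \<forall>d\<in>h ` V. c - d \<in> M \<longrightarrow> c = d"
  proof (intro ballI impI)
    fix c d assume "c \<in> h ` V" "d \<in> h ` V" and cd: "c - d \<in> M"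
    then obtain v w where v: "v \<in> V" "c = h v" and w: "w \<in> V" "d = h w" by auto
    have "h c = h v" "h d = h w" using h_eq h v w by auto
    then show "c = d" using h_eq[OF cd] v w by simp
  qed
  moreover have "\<forall>v\<in>V. \<exists>c\<in>h ` V. c - (v + 0) \<in> M" using h by auto
  moreover have "\<forall>m\<in>M. m \<noteq> 0 \<longrightarrow> (\<forall>x\<in>M. \<exists>k::int. x = k * m) \<longrightarrow> (\<forall>c\<in>h ` V. 0 < c \<and> c < \<bar>m\<bar>)"
    using False by blast
  ultimately show ?thesis using V by (intro exI[of _ 0] exI[of _ "h ` V"] conjI) auto
qed

lemma action_preorder_subset:
  assumes "action_preorder (G\<lparr>carrier := P\<rparr>) X \<phi> R" "K \<subseteq> P" "Y \<subseteq> X" "stable \<phi> K Y"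
  shows "action_preorder (G\<lparr>carrier := K\<rparr>) Y \<phi> (R \<inter> Y \<times> Y)"
  using assms
  by (auto simp: action_preorder_def preorder_on_def refl_on_def total_on_def stable_def subset_iff
      intro!: transI dest: transD)

section \<open>Realizable preorders and the assembly of a vertex from the fibres of
  \<open>g\<close>\<close>

context comm_group_action
begin

text \<open>The converse for a pair of labels inside the fixed action: \<open>tree_ok\<close> refers
  to \<open>G\<close>, so trees realizing smaller pairs can be attached directly as
  children.\<close>

definition realizable :: "'a set \<Rightarrow> 'c set \<Rightarrow> 'c rel \<Rightarrow> bool"
  where "realizable P X R \<longleftrightarrow> (\<exists>\<tau> f g. tree_ok \<tau> \<and> grp \<tau> = P \<and> pts \<tau> = X \<and>
    numerical_data G \<phi> \<tau> f g \<and> determined_rel \<phi> \<tau> g = R)"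

end

context graded_action
begin

lemma piece_pieces:
  assumes distinct: "\<And>i j. i \<in> I \<Longrightarrow> j \<in> I \<Longrightarrow> c i - c j \<in> f ` P \<Longrightarrow> i = j"
    and cover: "\<And>s. s \<in> X \<Longrightarrow> \<exists>i\<in>I. c i - g s \<in> f ` P"
  shows "graded_pieces G S \<phi> P X f g K I (\<lambda>i. {s \<in> X. g s = c i})"
proof
  fix s assume s: "s \<in> X"
  then obtain i u where "i \<in> I" "u \<in> P" "c i - g s = f u" using cover by blast
  then show "\<exists>u\<in>P. \<exists>i\<in>I. \<phi> u s \<in> {s \<in> X. g s = c i}"
    using s g_act act_X by (intro bexI[of _ u] bexI[of _ i]) auto
qed (use distinct g_act act_X in \<open>auto simp: stable_def K\<close>)

end

context graded_pieces
begin

text \<open>Two translates of \<open>s\<close> lying in pieces differ by an element of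
  \<open>K\<close>. This yields the preotree condition that the children meet each orbit of
  \<open>P\<close> in exactly one orbit of \<open>K\<close>.\<close>

lemma pieces_Int_orbit:
  assumes "u \<in> P" "i \<in> I" "s \<in> X" "\<phi> u s \<in> Y i"
  shows "(\<Union>j\<in>I. Y j) \<inter> orbit (G\<lparr>carrier := P\<rparr>) \<phi> s = orbit (G\<lparr>carrier := K\<rparr>) \<phi> (\<phi> u s)"
proof (intro equalityI subsetI)
  fix x assume "x \<in> (\<Union>j\<in>I. Y j) \<inter> orbit (G\<lparr>carrier := P\<rparr>) \<phi> s"
  then obtain v j where v: "v \<in> P" "j \<in> I" "x = \<phi> v s" "\<phi> v s \<in> Y j" by (auto simp: orbit_def)
  obtain w where w: "w \<in> K" "v = w \<otimes> u"
    using same_piece(3)[of i j u v s s] assms v by auto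
  then have "x = \<phi> w (\<phi> u s)" using v assms act_mult by (auto simp: K)
  then show "x \<in> orbit (G\<lparr>carrier := K\<rparr>) \<phi> (\<phi> u s)" using w by (auto simp: orbit_def)
next
  fix x assume "x \<in> orbit (G\<lparr>carrier := K\<rparr>) \<phi> (\<phi> u s)"
  then obtain w where w: "w \<in> K" "x = \<phi> w (\<phi> u s)" by (auto simp: orbit_def)
  then have "x \<in> Y i" using Y_stable[OF assms(2)] assms by (auto simp: stable_def)
  moreover have "x = \<phi> (w \<otimes> u) s" "w \<otimes> u \<in> P" using w assms act_mult P_closed by (auto simp: K)
  ultimately show "x \<in> (\<Union>j\<in>I. Y j) \<inter> orbit (G\<lparr>carrier := P\<rparr>) \<phi> s"
    using assms by (auto simp: orbit_def)
qed

text \<open>By totality and monotonicity of \<open>g\<close>, a strict inequality of values forces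
  the relation. In a tie, invariance of \<open>R\<close> carries both points into a common piece and
  back.\<close>

lemma lex_rel_restrict:
  assumes R: "action_preorder (G\<lparr>carrier := P\<rparr>) X \<phi> R"
    and mono: "\<And>s t. (s, t) \<in> R \<Longrightarrow> g s \<le> g t"
  shows "lex_rel P X \<phi> g I Y (\<lambda>i. R \<inter> Y i \<times> Y i) = R"
proof -
  interpret preordered_action G S \<phi> P X R by unfold_locales (rule R)
  have restr: "action_preorder (G\<lparr>carrier := K\<rparr>) (Y i) \<phi> (R \<inter> Y i \<times> Y i)" if i: "i \<in> I" for i
    by (rule action_preorder_subset[OF R _ Y[OF i] Y_stable[OF i]]) (auto simp: K)
  show ?thesis
  proof (intro equalityI subrelI)
    fix s t assume st: "(s, t) \<in> lex_rel P X \<phi> g I Y (\<lambda>i. R \<inter> Y i \<times> Y i)"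
    then have X: "s \<in> X" "t \<in> X" by (auto simp: lex_rel_def)
    show "(s, t) \<in> R"
    proof (cases "g s < g t")
      case True
      then show ?thesis using mono[of t s] R_total X by auto
    next
      case False
      then obtain u where "u \<in> P" "(\<phi> u s, \<phi> u t) \<in> R" using st by (auto simp: lex_rel_def)
      then show ?thesis using R_act_inv[of u s "\<phi> u t"] X P_carrier X_S act_inv by auto
    qed
  next
    fix s t assume st: "(s, t) \<in> R"
    then have X: "s \<in> X" "t \<in> X" using R_sub by auto
    show "(s, t) \<in> lex_rel P X \<phi> g I Y (\<lambda>i. R \<inter> Y i \<times> Y i)"
    proof (cases "g s = g t")
      case True
      obtain u i where u: "u \<in> P" "i \<in> I" "\<phi> u s \<in> Y i" using cover[OF X(1)] by auto
      obtain v j where v: "v \<in> P" "j \<in> I" "\<phi> v t \<in> Y j" using cover[OF X(2)] by auto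
      have "\<phi> u t \<in> Y i" using same_piece(2)[of i j u v s t] u v True X by auto
      then show ?thesis using lex_rel_iff[OF restr X True u] R_act[OF u(1) st] u by auto
    next
      case False
      then show ?thesis using mono[OF st] X by (auto simp: lex_rel_def)
    qed
  qed
qed

end

context graded_action
begin

text \<open>Joins trees realizing the fibres over \<open>C\<close> under a new root. The condition
  on cyclic images is stated through values of \<open>f\<close>, and
  \<open>generator_of_quotient\<close> supplies the passage from the quotient. Saturation of
  \<open>K\<close> in \<open>P\<close> and of \<open>P\<close> in \<open>G\<close> comes from purity
  and finite generation.\<close>

lemma realizable_step:
  assumes pure: "pure_subgroup G P" and fgG: "finitely_generated_group G"
    and A: "finite A" "A \<subseteq> P" "generate G A = P"
    and C: "finite C" and distinct: "\<And>c d. c \<in> C \<Longrightarrow> d \<in> C \<Longrightarrow> c - d \<in> f ` P \<Longrightarrow> c = d"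
    and cover: "\<And>s. s \<in> X \<Longrightarrow> \<exists>c\<in>C. c - g s \<in> f ` P"
    and rank1: "\<And>u\<^sub>0 c. u\<^sub>0 \<in> P \<Longrightarrow> f u\<^sub>0 \<noteq> 0 \<Longrightarrow> \<forall>u\<in>P. \<exists>k::int. f u = k * f u\<^sub>0 \<Longrightarrow> c \<in> C \<Longrightarrow>
        0 < c \<and> c < \<bar>f u\<^sub>0\<bar>"
    and R: "action_preorder (G\<lparr>carrier := P\<rparr>) X \<phi> R"
    and mono: "\<And>s t. (s, t) \<in> R \<Longrightarrow> g s \<le> g t"
    and ne: "X \<noteq> {}"
    and IH: "\<And>c. c \<in> C \<Longrightarrow>
        realizable K {s \<in> X. g s = c} (R \<inter> {s \<in> X. g s = c} \<times> {s \<in> X. g s = c})"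
  shows "realizable P X R"
proof -
  obtain cs where cs: "set cs = C" "distinct cs" using C finite_distinct_list by blast
  have csC: "cs ! i \<in> C" if "i < length cs" for i using that cs by auto
  \<comment> \<open>The new vertex must not be a leaf, for a leaf would determine the full
    relation.\<close>
  have "cs \<noteq> []" using ne cover cs by force
  define Q where "Q c \<tau> f' g' \<longleftrightarrow> tree_ok \<tau> \<and> grp \<tau> = K \<and> pts \<tau> = {s \<in> X. g s = c} \<and>
      numerical_data G \<phi> \<tau> f' g' \<and>
      determined_rel \<phi> \<tau> g' = R \<inter> {s \<in> X. g s = c} \<times> {s \<in> X. g s = c}" for c \<tau> f' g'
  have "\<forall>c. \<exists>\<tau> f' g'. c \<in> C \<longrightarrow> Q c \<tau> f' g'"
    using IH unfolding realizable_def Q_def by blast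
  then obtain T F D where "\<forall>c. c \<in> C \<longrightarrow> Q c (T c) (F c) (D c)"
    unfolding choice_iff by blast
  note T = this[rule_format, unfolded Q_def]
  define ts where "ts = map T cs"
  \<comment> \<open>The empty position carries the new data; below child \<open>i\<close> the data
    of the tree chosen for the value \<open>cs ! i\<close> are inherited.\<close>
  define ff where "ff = (\<lambda>p. case p of [] \<Rightarrow> f | i # q \<Rightarrow> F (cs ! i) q)"
  define gg where "gg = (\<lambda>p. case p of [] \<Rightarrow> g | i # q \<Rightarrow> D (cs ! i) q)"
  let ?P = "G\<lparr>carrier := P\<rparr>"
  have ts_ne: "ts \<noteq> []" using \<open>cs \<noteq> []\<close> by (simp add: ts_def)
  have ts_nth: "pts (ts ! i) = {s \<in> X. g s = cs ! i}" "grp (ts ! i) = K" "tree_ok (ts ! i)"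
    "numerical_data G \<phi> (ts ! i) (\<lambda>p. ff (i # p)) (\<lambda>p. gg (i # p))"
    "determined_rel \<phi> (ts ! i) (\<lambda>p. gg (i # p)) = R \<inter> pts (ts ! i) \<times> pts (ts ! i)"
    if "i < length ts" for i
    using that T csC by (auto simp: ts_def ff_def gg_def)
  have child: "\<exists>c\<in>C. pts y = {s \<in> X. g s = c} \<and> grp y = K \<and> tree_ok y" if "y \<in> set ts" for y
    using that T cs by (auto simp: ts_def)
  interpret Y: graded_pieces G S \<phi> P X f g K "{..<length ts}" "\<lambda>i. {s \<in> X. g s = cs ! i}"
  proof (rule piece_pieces)
    show "i = j" if "i \<in> {..<length ts}" "j \<in> {..<length ts}" "cs ! i - cs ! j \<in> f ` P" for i j
      using that distinct[of "cs ! i" "cs ! j"] cs by (auto simp: ts_def nth_eq_iff_index_eq)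
    show "\<exists>i\<in>{..<length ts}. cs ! i - g s \<in> f ` P" if "s \<in> X" for s
      using cover[OF that] cs by (force simp: ts_def in_set_conv_nth)
  qed
  interpret GP: comm_group ?P by (rule comm_group_restrict[OF P])
  have "pure_subgroup ?P K" by (rule pure_subgroup_restrict[OF pure_K[OF pure] P]) (auto simp: K)
  then have satK: "saturated ?P K"
    by (rule GP.pure_subgroup_structure(1)[OF _ A(1)]) (use A generate_consistent[OF A(2) P] in auto)
  obtain A0 where "finite A0" "A0 \<subseteq> carrier G" "generate G A0 = carrier G"
    using fgG by (auto simp: finitely_generated_group_def)
  from pure_subgroup_structure(1)[OF pure this] have satP: "saturated G P" .
  have Union: "(\<Union>z\<in>set ts. pts z) = (\<Union>i<length ts. {s \<in> X. g s = cs ! i})"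
    using ts_nth(1) by (fastforce simp: in_set_conv_nth)
  have orbits: "(\<Union>z\<in>set ts. pts z) \<inter> B \<in> orbits (G\<lparr>carrier := K\<rparr>) X \<phi>"
    if B: "B \<in> orbits ?P X \<phi>" for B
  proof -
    obtain s where s: "s \<in> X" "B = orbit ?P \<phi> s" using B by (auto simp: orbits_def)
    obtain u i where u: "u \<in> P" "i \<in> {..<length ts}" "\<phi> u s \<in> {s \<in> X. g s = cs ! i}"
      using Y.cover[OF s(1)] by blast
    from Y.pieces_Int_orbit[OF u(1,2) s(1) u(3)] show ?thesis
      unfolding Union s(2) using u(3) by (auto simp: orbits_def)
  qed
  have stab: "stabilizer ?P \<phi> s \<subseteq> K" if "s \<in> X" for s
  proof
    fix u assume "u \<in> stabilizer ?P \<phi> s"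
    then show "u \<in> K" using g_act[of u s] that by (auto simp: stabilizer_def K)
  qed
  have disj: "disjoint_family_on (\<lambda>i. pts (ts ! i)) {..<length ts}"
    using cs by (auto simp: disjoint_family_on_def ts_nth(1)) (auto simp: ts_def nth_eq_iff_index_eq)
  have "children_ok G \<phi> (Vertex P X ts)"
    unfolding children_ok_def ltree.sel
  proof (intro conjI ballI impI)
    fix y assume y: "y \<in> set ts"
    show "pts y \<subseteq> X" using child[OF y] by auto
    show "saturated ?P (grp y)" using child[OF y] satK by auto
    show "stabilizer ?P \<phi> s \<subseteq> grp y" if "s \<in> X" for s using child[OF y] stab[OF that] by auto
    show "grp y = grp z" if "z \<in> set ts" for z using child[OF y] child[OF that] by auto
    show "(\<Union>z\<in>set ts. pts z) \<inter> B \<in> orbits (G\<lparr>carrier := grp y\<rparr>) X \<phi>" if "B \<in> orbits ?P X \<phi>" for B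
      using orbits[OF that] child[OF y] by auto
  qed (rule disj)
  then have "tree_ok (Vertex P X ts)"
    using child satP X X_stable by (auto simp: tree_ok_Vertex vertex_ok_def)
  moreover have "vertex_data G \<phi> (Vertex P X ts) f g"
    unfolding vertex_data_def Let_def ltree.sel kernel_f
  proof (intro conjI ballI allI impI)
    show "f \<in> hom ?P real_group" by (rule f_hom)
    show "g (\<phi> u s) = f u + g s" if "u \<in> P" "s \<in> X" for u s using g_act that .
    fix y assume y: "y \<in> set ts"
    show "grp y = K" "\<exists>c. \<forall>s\<in>pts y. g s = c" using child[OF y] by auto
  next
    fix i j s t assume "i < length ts" "j < length ts" "i \<noteq> j" "s \<in> pts (ts ! i)" "t \<in> pts (ts ! j)"
    then show "f ` P #>\<^bsub>real_group\<^esub> g s \<noteq> f ` P #>\<^bsub>real_group\<^esub> g t"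
      using Y.coset_distinct[of i j s t] ts_nth(1) unfolding real_coset_eq_iff by auto
  next
    fix u\<^sub>0 y s assume "free_abelian_of_rank (?P Mod K) 1" "u\<^sub>0 \<in> P"
      "generate (?P Mod K) {K #>\<^bsub>?P\<^esub> u\<^sub>0} = carrier (?P Mod K)" and y: "y \<in> set ts" "s \<in> pts y"
    then have "f u\<^sub>0 \<noteq> 0" "\<forall>u\<in>P. \<exists>k::int. f u = k * f u\<^sub>0" using generator_of_quotient by auto
    then show "g s \<in> {0<..<\<bar>f u\<^sub>0\<bar>}"
      using rank1[OF \<open>u\<^sub>0 \<in> P\<close>] child[OF y(1)] y(2) by auto
  qed
  then have "numerical_data G \<phi> (Vertex P X ts) ff gg"
    using ts_nth(4) by (simp add: numerical_data_Vertex ff_def gg_def)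
  moreover have "determined_rel \<phi> (Vertex P X ts) gg =
      lex_rel P X \<phi> g {..<length ts} (\<lambda>i. {s \<in> X. g s = cs ! i})
        (\<lambda>i. R \<inter> {s \<in> X. g s = cs ! i} \<times> {s \<in> X. g s = cs ! i})"
    using ts_ne ts_nth by (auto simp: determined_rel_Vertex lex_rel_def gg_def)
  then have "determined_rel \<phi> (Vertex P X ts) gg = R"
    using Y.lex_rel_restrict[OF R mono] by simp
  ultimately show ?thesis unfolding realizable_def by (intro exI[of _ "Vertex P X ts"]) auto
qed

text \<open>On a fibre of \<open>g\<close>, only elements of \<open>K\<close> relate points of the
  same orbit of \<open>P\<close>. So a fibre has at most as many orbits under \<open>K\<close> as
  \<open>X\<close> has under \<open>P\<close>.\<close>

lemma orbits_piece:
  "orbits (G\<lparr>carrier := K\<rparr>) {s \<in> X. g s = c} \<phi> \<subseteq>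
    (\<lambda>B. B \<inter> {s \<in> X. g s = c}) ` orbits (G\<lparr>carrier := P\<rparr>) X \<phi>"
proof
  fix B assume "B \<in> orbits (G\<lparr>carrier := K\<rparr>) {s \<in> X. g s = c} \<phi>"
  then obtain y where y: "y \<in> X" "g y = c" "B = orbit (G\<lparr>carrier := K\<rparr>) \<phi> y"
    by (auto simp: orbits_def)
  have "B = orbit (G\<lparr>carrier := P\<rparr>) \<phi> y \<inter> {s \<in> X. g s = c}"
    using y act_X g_act by (auto simp: orbit_def K)
  then show "B \<in> (\<lambda>B. B \<inter> {s \<in> X. g s = c}) ` orbits (G\<lparr>carrier := P\<rparr>) X \<phi>"
    using y by (auto simp: orbits_def)
qed

end

context comm_group_action
begin

lemma realizable_leaf:
  assumes "saturated G P" "X \<subseteq> S" "stable \<phi> P X"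
  shows "realizable P X (X \<times> X)"
proof -
  have "tree_ok (Vertex P X [])"
    using assms by (simp add: tree_ok_Vertex vertex_ok_def children_ok_def)
  moreover have "numerical_data G \<phi> (Vertex P X []) f g" for f g
    by (simp add: numerical_data_Vertex)
  moreover have "determined_rel \<phi> (Vertex P X []) g = X \<times> X" for g
    by (simp add: determined_rel_Vertex)
  ultimately show ?thesis unfolding realizable_def by (metis ltree.sel(1,2))
qed

end

section \<open>Monotone equivariant functions when all orbits are coinitial\<close>

context preordered_action
begin

lemma ex_monotone_equivariant:
  assumes fg: "finitely_generated_group (G\<lparr>carrier := P\<rparr>)"
    and coinitial: "\<And>s t. s \<in> X \<Longrightarrow> t \<in> X \<Longrightarrow> \<exists>u\<in>P. (\<phi> u s, t) \<in> R"
    and nontrivial: "R \<noteq> X \<times> X"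
  shows "\<exists>f g. graded_action G S \<phi> P X f g {u \<in> P. f u = 0} \<and> (\<exists>u\<in>P. f u \<noteq> 0) \<and>
    (\<forall>s t. (s, t) \<in> R \<longrightarrow> g s \<le> g t)"
proof -
  let ?P = "G\<lparr>carrier := P\<rparr>"
  obtain s0 t0 where st0: "s0 \<in> X" "t0 \<in> X" "(s0, t0) \<notin> R" using nontrivial R_sub by auto
  \<comment> \<open>The cone of the preorder on \<open>P\<close> that compares \<open>u\<close> and
    \<open>v\<close> by the translates of \<open>s0\<close>.\<close>
  define N where "N = {u \<in> P. (s0, \<phi> u s0) \<in> R}"
  interpret P: comm_group ?P by (rule comm_group_restrict[OF P])
  interpret N: group_cone ?P N
  proof
    show "N \<subseteq> carrier ?P" by (auto simp: N_def)
    show "u \<otimes>\<^bsub>?P\<^esub> v \<in> N" if uv: "u \<in> N" "v \<in> N" for u v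
    proof -
      have "(\<phi> u s0, \<phi> u (\<phi> v s0)) \<in> R" using uv by (intro R_act) (auto simp: N_def)
      then show ?thesis using uv R_trans[of s0 "\<phi> u s0"] P_closed act_mult st0 by (auto simp: N_def)
    qed
    show "u \<in> N \<or> inv\<^bsub>?P\<^esub> u \<in> N" if u: "u \<in> carrier ?P" for u
    proof (cases "(s0, \<phi> u s0) \<in> R")
      case True
      then show ?thesis using u by (auto simp: N_def)
    next
      case False
      then have "(\<phi> u s0, s0) \<in> R" using R_total[of s0 "\<phi> u s0"] st0 act_X u by auto
      then have "(s0, \<phi> (inv u) s0) \<in> R" using u st0 by (intro R_act_inv) auto
      then show ?thesis using u P_closed m_inv_consistent[OF P] by (auto simp: N_def)
    qed
  qed
  obtain u0 where u0: "u0 \<in> P" "(\<phi> u0 s0, t0) \<in> R" using coinitial st0 by blast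
  \<comment> \<open>If \<open>s0\<close> were below its translate by \<open>u0\<close>, it would be
    below \<open>t0\<close>, contrary to the choice of \<open>s0\<close> and \<open>t0\<close>. So
    the cone is proper and Hoelder's argument applies.\<close>
  then have "u0 \<notin> N" using R_trans[of s0 "\<phi> u0 s0" t0] st0 by (auto simp: N_def)
  then have "N \<noteq> carrier ?P" using u0 by auto
  from N.ex_monotone_hom[OF fg this] obtain f where f: "f \<in> hom ?P real_group" "\<forall>u\<in>N. 0 \<le> f u"
    "\<exists>u\<in>P. f u \<noteq> 0" by auto
  have fm: "f (u \<otimes> v) = f u + f v" if "u \<in> P" "v \<in> P" for u v
    using f(1) that by (auto simp: hom_def real_group_def)
  have f1: "f \<one> = 0" using fm[of \<one> \<one>] P_closed by auto
  have fi: "f (inv u) = - f u" if "u \<in> P" for u using fm[of u "inv u"] that P_closed P_carrier f1 by auto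
  have f_mono: "f u \<le> f v" if uv: "u \<in> P" "v \<in> P" "(\<phi> u s0, \<phi> v s0) \<in> R" for u v
  proof -
    have "(s0, \<phi> (inv u) (\<phi> v s0)) \<in> R" using uv st0 by (intro R_act_inv)
    then have "inv u \<otimes> v \<in> N" using uv P_closed st0 act_mult by (auto simp: N_def)
    then have "0 \<le> f (inv u \<otimes> v)" using f by auto
    then show ?thesis using fm fi uv P_closed by auto
  qed
  define L where "L t = {f u | u. u \<in> P \<and> (\<phi> u s0, t) \<in> R}" for t
  define g where "g t = Sup (L t)" for t
  have L_ne: "L t \<noteq> {}" if "t \<in> X" for t using coinitial[OF st0(1) that] by (auto simp: L_def)
  \<comment> \<open>Coinitiality of the orbit of \<open>t\<close> bounds \<open>t\<close> above by a
    translate of \<open>s0\<close>, while coinitiality of the orbit of \<open>s0\<close> makes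
    \<open>L t\<close> nonempty.\<close>
  have L_bdd: "bdd_above (L t)" if t: "t \<in> X" for t
  proof -
    obtain u where u: "u \<in> P" "(\<phi> u t, s0) \<in> R" using coinitial[OF t st0(1)] by auto
    have "(t, \<phi> (inv u) s0) \<in> R" using u t by (intro R_act_inv)
    then show ?thesis
      using f_mono R_trans u P_closed by (intro bdd_aboveI[of _ "f (inv u)"]) (auto simp: L_def)
  qed
  have g_ge: "f w + g t \<le> g (\<phi> w t)" if w: "w \<in> P" and t: "t \<in> X" for w t
  proof -
    have "x \<le> g (\<phi> w t) - f w" if x: "x \<in> L t" for x
    proof -
      obtain u where u: "u \<in> P" "(\<phi> u s0, t) \<in> R" "x = f u" using x by (auto simp: L_def)
      have "(\<phi> (w \<otimes> u) s0, \<phi> w t) \<in> R" using R_act[OF w u(2)] act_mult w u st0 by auto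
      then have "f (w \<otimes> u) \<in> L (\<phi> w t)" using u w P_closed by (auto simp: L_def)
      then have "f (w \<otimes> u) \<le> g (\<phi> w t)"
        unfolding g_def using L_bdd act_X w t by (intro cSup_upper) auto
      then show ?thesis using fm u w by auto
    qed
    then have "g t \<le> g (\<phi> w t) - f w" unfolding g_def[of t] using L_ne[OF t] by (intro cSup_least) auto
    then show ?thesis by simp
  qed
  \<comment> \<open>The inequality for \<open>w\<close> at \<open>t\<close> and that for
    \<open>inv w\<close> at the translate of \<open>t\<close> combine to an equality.\<close>
  have g_act: "g (\<phi> w t) = f w + g t" if w: "w \<in> P" and t: "t \<in> X" for w t
    using g_ge[OF w t] g_ge[of "inv w" "\<phi> w t"] act_inv[of w t] fi w t P_closed act_X P_carrier X_S by auto
  have "g s \<le> g t" if st: "(s, t) \<in> R" for s t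
    unfolding g_def
    by (rule cSup_subset_mono) (use st R_sub L_ne L_bdd R_trans in \<open>auto simp: L_def\<close>)
  moreover have "graded_action G S \<phi> P X f g {u \<in> P. f u = 0}"
    by (intro graded_action.intro graded_action_axioms.intro stable_subset_axioms)
      (use fm g_act in auto)
  ultimately show ?thesis using f(3) by blast
qed

end

section \<open>The induction on the numbers of generators and orbits\<close>

context comm_group_action
begin

theorem action_preorder_realizable:
  assumes fgG: "finitely_generated_group G" and "finite A" "A \<subseteq> P" "generate G A = P"
    and "pure_subgroup G P" "X \<subseteq> S" "stable \<phi> P X" "finite (orbits (G\<lparr>carrier := P\<rparr>) X \<phi>)"
    and "action_preorder (G\<lparr>carrier := P\<rparr>) X \<phi> R"
  shows "realizable P X R"
  using assms(2-)
proof (induction "card A + card (orbits (G\<lparr>carrier := P\<rparr>) X \<phi>)" arbitrary: A P X R rule: less_induct)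
  case less
  let ?P = "G\<lparr>carrier := P\<rparr>"
  have P: "subgroup P G" using less.prems by (auto simp: pure_subgroup_def)
  interpret preordered_action G S \<phi> P X R
    by (intro preordered_action.intro preordered_action_axioms.intro stable_subset.intro
        stable_subset_axioms.intro comm_group_action_axioms P less.prems)
  \<comment> \<open>The vertex is a leaf, or all orbits are coinitial, or the orbit of
    \<open>s\<close> has no element below \<open>t\<close>.\<close>
  consider "R = X \<times> X" | "R \<noteq> X \<times> X" "\<forall>s\<in>X. \<forall>t\<in>X. \<exists>u\<in>P. (\<phi> u s, t) \<in> R"
    | s t where "s \<in> X" "t \<in> X" "\<forall>u\<in>P. (\<phi> u s, t) \<notin> R" by blast
  then show ?case
  proof cases
    case 1
    obtain A0 where "finite A0" "A0 \<subseteq> carrier G" "generate G A0 = carrier G"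
      using fgG by (auto simp: finitely_generated_group_def)
    from pure_subgroup_structure(1)[OF less.prems(4) this] show ?thesis
      using realizable_leaf less.prems 1 by simp
  next
    case 2
    have gen: "generate ?P A = carrier ?P" using less.prems generate_consistent[OF _ P] by auto
    then have "finitely_generated_group ?P"
      using less.prems by (auto simp: finitely_generated_group_def)
    from ex_monotone_equivariant[OF this _ 2(1)] 2(2) obtain f g0
      where "graded_action G S \<phi> P X f g0 {u \<in> P. f u = 0}" and f_ne: "\<exists>u\<in>P. f u \<noteq> 0"
        and g0_mono: "\<forall>s t. (s, t) \<in> R \<longrightarrow> g0 s \<le> g0 t"
      by blast
    then interpret g0: graded_action G S \<phi> P X f g0 "{u \<in> P. f u = 0}" by simp
    define K where "K = {u \<in> P. f u = 0}"
    \<comment> \<open>One value for each orbit suffices: the values of \<open>g0\<close> on an orbit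
      fill a single coset of the image of \<open>f\<close>.\<close>
    define V where "V = (\<lambda>B. g0 (SOME x. x \<in> B)) ` orbits ?P X \<phi>"
    have V: "finite V" unfolding V_def using less.prems by auto
    have M: "\<forall>x\<in>f ` P. \<forall>y\<in>f ` P. x - y \<in> f ` P"
    proof (intro ballI)
      fix x y assume xy: "x \<in> f ` P" "y \<in> f ` P"
      obtain u v where uv: "u \<in> P" "v \<in> P" "x = f u" "y = f v" using xy by auto
      then have "x - y = f (u \<otimes> inv v)" using g0.f_mult g0.f_inv P_closed by auto
      then show "x - y \<in> f ` P" using uv P_closed by auto
    qed
    have M0: "0 \<in> f ` P" using g0.f_one P_closed by force
    from real_transversal[OF V M0 M] obtain \<delta> C where C: "finite C"
      "\<forall>c\<in>C. \<forall>d\<in>C. c - d \<in> f ` P \<longrightarrow> c = d" "\<forall>v\<in>V. \<exists>c\<in>C. c - (v + \<delta>) \<in> f ` P"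
      "\<forall>m\<in>f ` P. m \<noteq> 0 \<longrightarrow> (\<forall>x\<in>f ` P. \<exists>k::int. x = k * m) \<longrightarrow> (\<forall>c\<in>C. 0 < c \<and> c < \<bar>m\<bar>)"
      by (elim exE conjE) (rule that)
    \<comment> \<open>The shift preserves monotonicity and equivariance, and places the values on
      the children where the condition on cyclic images wants them.\<close>
    define g where "g s = g0 s + \<delta>" for s
    interpret g: graded_action G S \<phi> P X f g K
      by (intro graded_action.intro graded_action_axioms.intro stable_subset_axioms)
        (use g0.f_mult g0.g_act in \<open>auto simp: g_def K_def\<close>)
    have KP: "K \<subseteq> P" by (auto simp: K_def)
    interpret P: comm_group ?P by (rule comm_group_restrict[OF P])
    have pure: "pure_subgroup G K" by (rule g.pure_K[OF less.prems(4)])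
    have "pure_subgroup ?P K" by (rule pure_subgroup_restrict[OF pure P KP])
    moreover have "K \<noteq> carrier ?P" using f_ne by (auto simp: K_def)
    moreover have "A \<subseteq> carrier ?P" using less.prems by simp
    \<comment> \<open>As \<open>f\<close> is nonzero, its kernel is a proper pure subgroup and has
      fewer generators than \<open>A\<close>; the number of orbits does not grow.\<close>
    ultimately obtain A' where A': "finite A'" "A' \<subseteq> K" "generate ?P A' = K" "card A' < card A"
      using P.pure_subgroup_structure(2)[of K A] gen less.prems(1) by blast
    have gA': "generate G A' = K" using generate_consistent[OF _ P, of A'] A' KP by auto
    show ?thesis
    proof (rule g.realizable_step[OF less.prems(4) fgG less.prems(1-3) C(1)])
      show "c = d" if "c \<in> C" "d \<in> C" "c - d \<in> f ` P" for c d using C(2) that by blast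
      show "0 < c \<and> c < \<bar>f u\<^sub>0\<bar>"
        if "u\<^sub>0 \<in> P" "f u\<^sub>0 \<noteq> 0" "\<forall>u\<in>P. \<exists>k::int. f u = k * f u\<^sub>0" "c \<in> C" for u\<^sub>0 c
        using C(4) that by blast
      show "\<exists>c\<in>C. c - g s \<in> f ` P" if s: "s \<in> X" for s
      proof -
        define B where "B = orbit ?P \<phi> s"
        have "s \<in> B" using act_one[OF X_S[OF s]] P_closed by (force simp: B_def orbit_def)
        then have "(SOME x. x \<in> B) \<in> B" by (rule someI)
        then obtain u where u: "u \<in> P" "(SOME x. x \<in> B) = \<phi> u s" by (auto simp: B_def orbit_def)
        have "B \<in> orbits ?P X \<phi>" using s by (auto simp: B_def orbits_def)
        then have "g0 (\<phi> u s) \<in> V" using u by (force simp: V_def)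
        then obtain c where c: "c \<in> C" "c - (g0 (\<phi> u s) + \<delta>) \<in> f ` P" using C(3) by blast
        then obtain v where "v \<in> P" "c - (g0 (\<phi> u s) + \<delta>) = f v" by auto
        then have "c - g s = f (u \<otimes> v)" "u \<otimes> v \<in> P"
          using u s P_closed g0.g_act g0.f_mult by (auto simp: g_def)
        then show ?thesis using c(1) by blast
      qed
      show "g s \<le> g t" if "(s, t) \<in> R" for s t using g0_mono that by (simp add: g_def)
      show "X \<noteq> {}" using 2(1) R_sub by auto
      fix c assume "c \<in> C"
      define Y where "Y = {s \<in> X. g s = c}"
      have st: "stable \<phi> K Y" using act_X g.g_act by (auto simp: stable_def Y_def K_def)
      have orb: "orbits (G\<lparr>carrier := K\<rparr>) Y \<phi> \<subseteq> (\<lambda>B. B \<inter> Y) ` orbits ?P X \<phi>"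
        unfolding Y_def by (rule g.orbits_piece)
      then have fin: "finite (orbits (G\<lparr>carrier := K\<rparr>) Y \<phi>)"
        using less.prems(7) finite_subset by blast
      have "card (orbits (G\<lparr>carrier := K\<rparr>) Y \<phi>) \<le> card ((\<lambda>B. B \<inter> Y) ` orbits ?P X \<phi>)"
        using orb less.prems(7) by (intro card_mono) auto
      also have "\<dots> \<le> card (orbits ?P X \<phi>)" using less.prems(7) by (intro card_image_le)
      finally have "card A' + card (orbits (G\<lparr>carrier := K\<rparr>) Y \<phi>) < card A + card (orbits ?P X \<phi>)"
        using A'(4) by linarith
      then have "realizable K Y (R \<inter> Y \<times> Y)"
      proof (rule less.hyps)
        show "finite A'" "A' \<subseteq> K" "generate G A' = K" "pure_subgroup G K" by (fact A' gA' pure)+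
        show "Y \<subseteq> S" using X_S by (auto simp: Y_def)
        show "stable \<phi> K Y" by (fact st)
        show "finite (orbits (G\<lparr>carrier := K\<rparr>) Y \<phi>)" by (fact fin)
        show "action_preorder (G\<lparr>carrier := K\<rparr>) Y \<phi> (R \<inter> Y \<times> Y)"
          by (rule action_preorder_subset[OF R KP _ st]) (auto simp: Y_def)
      qed
      then show "realizable K {s \<in> X. g s = c} (R \<inter> {s \<in> X. g s = c} \<times> {s \<in> X. g s = c})"
        by (simp add: Y_def)
    qed (fact R)
  next
    case (3 s t)
    \<comment> \<open>A stable initial segment of \<open>X\<close> that contains \<open>t\<close>
      but not \<open>s\<close>.\<close>
    define X1 where "X1 = {x \<in> X. \<exists>u\<in>P. (\<phi> u x, t) \<in> R}"
    \<comment> \<open>With \<open>f\<close> zero, the kernel is all of \<open>P\<close> and cosets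
      of the image are single numbers. Hence 1 and 2 form a transversal, and the condition on cyclic
      images is vacuous.\<close>
    define f where "f = (\<lambda>_::'a. 0 :: real)"
    define g where "g = (\<lambda>x. if x \<in> X1 then 1 else 2 :: real)"
    have one_t: "(\<phi> \<one> t, t) \<in> R" using act_one X_S R_refl 3 by auto
    have t1: "t \<in> X1" using one_t 3 P_closed by (auto simp: X1_def)
    have s1: "s \<notin> X1" using 3 by (auto simp: X1_def)
    have act_X1: "\<phi> u x \<in> X1 \<longleftrightarrow> x \<in> X1" if u: "u \<in> P" and x: "x \<in> X" for u x
    proof
      assume "\<phi> u x \<in> X1"
      then obtain v where "v \<in> P" "(\<phi> v (\<phi> u x), t) \<in> R" by (auto simp: X1_def)
      then show "x \<in> X1" using u x act_mult P_closed by (auto simp: X1_def intro!: bexI[of _ "v \<otimes> u"])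
    next
      assume "x \<in> X1"
      then obtain v where v: "v \<in> P" "(\<phi> v x, t) \<in> R" by (auto simp: X1_def)
      have "\<phi> (v \<otimes> inv u) (\<phi> u x) = \<phi> v x" using u x v act_mult P_closed act_X act_inv P_carrier X_S by auto
      then show "\<phi> u x \<in> X1"
        using u x v P_closed act_X by (auto simp: X1_def intro!: bexI[of _ "v \<otimes> inv u"])
    qed
    interpret g: graded_action G S \<phi> P X f g P
      by (intro graded_action.intro graded_action_axioms.intro stable_subset_axioms)
        (use act_X1 in \<open>auto simp: g_def f_def\<close>)
    show ?thesis
    proof (rule g.realizable_step[OF less.prems(4) fgG less.prems(1-3), where C = "{1, 2}"])
      show "finite {1, 2::real}" by simp
      show "c = d" if "c - d \<in> f ` P" for c d using that by (auto simp: f_def)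
      show "\<exists>c\<in>{1, 2}. c - g x \<in> f ` P" for x using P_closed by (auto simp: f_def g_def)
      show "0 < c \<and> c < \<bar>f u\<^sub>0\<bar>" if "f u\<^sub>0 \<noteq> 0" for u\<^sub>0 c using that by (simp add: f_def)
      \<comment> \<open>Monotonicity of \<open>g\<close> means that \<open>X1\<close> is closed
        downwards: a translate of \<open>y\<close> below \<open>t\<close> gives a translate of
        \<open>x\<close> below \<open>t\<close>.\<close>
      show "g x \<le> g y" if xy: "(x, y) \<in> R" for x y
      proof -
        have "x \<in> X1" if y: "y \<in> X1"
        proof -
          obtain v where v: "v \<in> P" "(\<phi> v y, t) \<in> R" using y by (auto simp: X1_def)
          have "(\<phi> v x, t) \<in> R" using R_trans[OF R_act[OF v(1) xy] v(2)] .
          then show ?thesis using v xy R_sub by (auto simp: X1_def)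
        qed
        then show ?thesis by (simp add: g_def)
      qed
      show "X \<noteq> {}" using 3 by auto
      fix c :: real assume c: "c \<in> {1, 2}"
      define Y where "Y = {x \<in> X. g x = c}"
      have st: "stable \<phi> P Y" using act_X act_X1 by (auto simp: stable_def Y_def g_def)
      \<comment> \<open>Each of the two fibres misses \<open>s\<close> or \<open>t\<close>, and
        being stable it misses the whole orbit of that point. So the number of orbits drops while
        the group stays the same.\<close>
      obtain z where z: "z \<in> X" "z \<notin> Y" using c 3 t1 s1 by (auto simp: Y_def g_def)
      have "orbit ?P \<phi> z \<notin> orbits ?P Y \<phi>"
      proof
        assume "orbit ?P \<phi> z \<in> orbits ?P Y \<phi>"
        then obtain y where y: "y \<in> Y" "orbit ?P \<phi> z = orbit ?P \<phi> y" by (auto simp: orbits_def)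
        have "z \<in> orbit ?P \<phi> z" using act_one[OF X_S[OF z(1)]] P_closed by (force simp: orbit_def)
        then have "z \<in> orbit ?P \<phi> y" using y(2) by metis
        then show False using y(1) z(2) st by (auto simp: orbit_def stable_def)
      qed
      moreover have "orbit ?P \<phi> z \<in> orbits ?P X \<phi>" using z by (auto simp: orbits_def)
      moreover have sub: "orbits ?P Y \<phi> \<subseteq> orbits ?P X \<phi>" by (auto simp: orbits_def Y_def)
      ultimately have "card (orbits ?P Y \<phi>) < card (orbits ?P X \<phi>)"
        using less.prems(7) by (intro psubset_card_mono) auto
      then have "card A + card (orbits ?P Y \<phi>) < card A + card (orbits ?P X \<phi>)" by simp
      then have "realizable P Y (R \<inter> Y \<times> Y)"
      proof (rule less.hyps)
        show "finite A" "A \<subseteq> P" "generate G A = P" "pure_subgroup G P" by (fact less.prems)+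
        show "Y \<subseteq> S" using X_S by (auto simp: Y_def)
        show "stable \<phi> P Y" by (fact st)
        show "finite (orbits ?P Y \<phi>)" using sub less.prems(7) finite_subset by blast
        show "action_preorder ?P Y \<phi> (R \<inter> Y \<times> Y)"
          by (rule action_preorder_subset[OF R _ _ st]) (auto simp: Y_def)
      qed
      then show "realizable P {x \<in> X. g x = c} (R \<inter> {x \<in> X. g x = c} \<times> {x \<in> X. g x = c})"
        by (simp add: Y_def)
    qed (fact R)
  qed
qed

end

theorem theorem4p20:
  fixes G :: "('g, 'm) monoid_scheme"
    and S :: "'s set"
    and \<phi> :: "'g \<Rightarrow> 's \<Rightarrow> 's"
  assumes "comm_group G"
    and "finitely_generated_group G"
    and "group_action G S \<phi>"
    and "finitely_generated_set G S \<phi>"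
  shows "(\<forall>\<tau> f g. preotree G S \<phi> \<tau> \<and> numerical_data G \<phi> \<tau> f g \<longrightarrow>
            action_preorder G S \<phi> (determined_rel \<phi> \<tau> g)) \<and>
         (\<forall>R. action_preorder G S \<phi> R \<longrightarrow>
            (\<exists>\<tau> f g. preotree G S \<phi> \<tau> \<and> numerical_data G \<phi> \<tau> f g \<and>
               R = determined_rel \<phi> \<tau> g))"
proof -
  interpret comm_group_action G S \<phi>
    using assms(1,3) by (simp add: comm_group_action_def)
  have carr: "action_preorder (G\<lparr>carrier := carrier G\<rparr>) S \<phi> R \<longleftrightarrow> action_preorder G S \<phi> R" for R
    by (simp add: action_preorder_def)
  show ?thesis
  proof (intro conjI allI impI)
    fix \<tau> f g assume "preotree G S \<phi> \<tau> \<and> numerical_data G \<phi> \<tau> f g"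
    then show "action_preorder G S \<phi> (determined_rel \<phi> \<tau> g)"
      using determined_rel_preorder[of \<tau> f g] carr by (auto simp: preotree_iff)
  next
    fix R assume R: "action_preorder G S \<phi> R"
    obtain A where A: "finite A" "A \<subseteq> carrier G" "generate G A = carrier G"
      using assms(2) by (auto simp: finitely_generated_group_def)
    have "realizable (carrier G) S R"
    proof (rule action_preorder_realizable[OF assms(2) A])
      show "pure_subgroup G (carrier G)" by (simp add: pure_subgroup_def subgroup_self)
      show "stable \<phi> (carrier G) S" using act_closed by (simp add: stable_def)
      show "finite (orbits (G\<lparr>carrier := carrier G\<rparr>) S \<phi>)"
        using assms(4) by (simp add: finitely_generated_set_def)
      show "action_preorder (G\<lparr>carrier := carrier G\<rparr>) S \<phi> R" using R carr by simp
    qed simp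
    then show "\<exists>\<tau> f g. preotree G S \<phi> \<tau> \<and> numerical_data G \<phi> \<tau> f g \<and> R = determined_rel \<phi> \<tau> g"
      unfolding realizable_def preotree_iff by metis
  qed
qed

end
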